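(* Consider the Sherrington–Kirkpatrick model with Hamiltonian $$\mathcal H_n(\mathbf X^n;\boldsymbol\sigma)=-\sum_{1\le i<j\le n}X_{n,(i,j)}\sigma_i\sigma_j,$$ where the disorder variables $\mathbf X^n=\{X_{n,(i,j)}:1\le i<j\le n\}$ are i.i.d. with common distribution $\mathcal P$ on $\mathbb R$ having zero mean and a density $f$ satisfying the rejection assumption of the context. Then the problem sequence of minimizing $\mathcal H_n(\mathbf X^n;\boldsymbol\sigma)$ over $\boldsymbol\sigma\in\mathcal S_n$ is stable under small perturbations with perturbation blocks $\mathcal J_n=\{J_{n,(i,j)}:(i,j)\in[n]^2,\ i<j\}$, where $J_{n,(i,j)}=\{(i,j)\}$ for all $1\le i<j\le n$.
   Context: Parameter space: $\mathcal S_n=\{\boldsymbol\sigma=(\sigma_1,\dots,\sigma_n):\sigma_1=+1,\ \sigma_i\in\{+1,-1\}\text{ for }2\le i\le n\}$ (one representative of each pair $\pm\boldsymbol\sigma$), with normalized Hamming metric $d_n(\boldsymbol\sigma,\boldsymbol\sigma')=\frac1n\sum_{i=1}^n\mathbf 1(\sigma_i\ne\sigma_i')$. The input index set is $I_n=\{(i,j):1\le i<j\le n\}$. The minimizer over $\mathcal S_n$ is almost surely unique, denoted $\widehat{\boldsymbol\sigma}(\mathbf X^n)$. $[n]=\{1,\dots,n\}$. Rejection assumption: for $X\sim\mathcal P$ and $W\sim N(0,1)$ independent and any $p,s\ge0$, $\mathbb E\bigl[|W|^p\bigl(1-f(X+sW)/f(X)\bigr)_+\bigr]\le C(f,p)\,s$,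 with $C(f,p)$ a finite positive constant depending only on $f$ and $p$. Stability. $\mathcal J_n=\{J_{n,l}:l\in\mathcal L_n\}$ is a finite family of subsets of $I_n$ with union $I_n$; $m_n=\operatorname{card}(\mathcal L_n)$. For each $l$, $\mathbf X^{n,l}$ is an independent copy of $\mathbf X^n$ (no further assumption on the joint law over $l$), and $\mathbf X^n_l$ is $\mathbf X^n$ with the coordinates in $J_{n,l}$ replaced by those of $\mathbf X^{n,l}$. For a metric $\mathsf d$, $P(T,\mathsf d,\varepsilon)$ is the largest cardinality of a subset of $T$ with pairwise distances $>\varepsilon$. With $\mathcal O_{n,A}=\{\widehat{\boldsymbol\sigma}(\mathbf X^n_l):l\in A\}$, the sequence is stable under small perturbations with perturbation blocks $\mathcal J_n$ if for any $\varepsilon,\delta>0$ there is $M(\varepsilon,\delta)<\infty$ with $\limsup_{n\to\infty}\mathbb P[\min_{A\subseteq\mathcal L_n:|A|>(1-\varepsilon)m_n}P(\mathcal O_{n,A},d_n,\varepsilon)\ge M(\varepsilon,\delta)]\le\delta$. *)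

theory Defs
  imports "HOL-Probability.Probability"
begin

definition random_vector :: "'i set \<Rightarrow> ('i \<Rightarrow> 'w \<Rightarrow> real) \<Rightarrow> 'w \<Rightarrow> 'i \<Rightarrow> real" where
  "random_vector I X \<omega> = (\<lambda>i\<in>I. X i \<omega>)"

definition independent_copy ::
    "'w measure \<Rightarrow> 'i set \<Rightarrow> ('i \<Rightarrow> 'w \<Rightarrow> real) \<Rightarrow> ('i \<Rightarrow> 'w \<Rightarrow> real) \<Rightarrow> bool" where
  "independent_copy M I X Y \<longleftrightarrow>
     prob_space.indep_var M
       (\<Pi>\<^sub>M i\<in>I. borel) (random_vector I X) (\<Pi>\<^sub>M i\<in>I. borel) (random_vector I Y) \<and>
     distr M (\<Pi>\<^sub>M i\<in>I. borel) (random_vector I Y) = distr M (\<Pi>\<^sub>M i\<in>I. borel) (random_vector I X)"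

text \<open>The joint law of the independent pair \<open>(X, W)\<close>, with \<open>X\<close> of law \<open>P\<close> and \<open>W\<close> standard
  normal, is a product measure. The integrand is dominated by \<open>\<bar>W\<bar> powr p\<close>, hence integrable
  for measurable \<open>f \<ge> 0\<close>. The conventions \<open>0 powr 0 = 0\<close> and \<open>a / 0 = 0\<close> matter only on null
  sets when \<open>f\<close> is a density of \<open>P\<close>.\<close>

definition rejection_assumption :: "real measure \<Rightarrow> (real \<Rightarrow> real) \<Rightarrow> bool" where
  "rejection_assumption P f \<longleftrightarrow>
     (\<forall>p\<ge>0. \<exists>C>0. \<forall>s\<ge>0.
        (\<integral>(x, w). \<bar>w\<bar> powr p * max 0 (1 - f (x + s * w) / f x)
           \<partial>(P \<Otimes>\<^sub>M density lborel std_normal_density)) \<le> C * s)"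

text \<open>Only meaningful if the cardinalities of such subsets are bounded; below, \<open>T\<close> is finite.\<close>

definition packing_number :: "'s set \<Rightarrow> ('s \<Rightarrow> 's \<Rightarrow> real) \<Rightarrow> real \<Rightarrow> nat" where
  "packing_number T d \<epsilon> =
     Max {card B | B. finite B \<and> B \<subseteq> T \<and> (\<forall>x\<in>B. \<forall>y\<in>B. x \<noteq> y \<longrightarrow> d x y > \<epsilon>)}"

definition perturbation_blocks :: "'i set \<Rightarrow> 'l set \<Rightarrow> ('l \<Rightarrow> 'i set) \<Rightarrow> bool" where
  "perturbation_blocks I L J \<longleftrightarrow> finite L \<and> (\<Union>l\<in>L. J l) = I"

definition perturbed_input ::
    "'i set \<Rightarrow> 'i set \<Rightarrow> ('i \<Rightarrow> 'w \<Rightarrow> real) \<Rightarrow> ('i \<Rightarrow> 'w \<Rightarrow> real) \<Rightarrow> 'w \<Rightarrow> 'i \<Rightarrow> real" where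
  "perturbed_input I B X Y \<omega> = (\<lambda>i\<in>I. if i \<in> B then Y i \<omega> else X i \<omega>)"

text \<open>Optimizers are taken with \<open>arg_min_on\<close>, which makes an unspecified choice of a minimizer
  (depending only on the input) when there are several; for problems with an almost surely
  unique minimizer this choice is irrelevant.\<close>

definition perturbed_optimizers ::
    "'i set \<Rightarrow> ('l \<Rightarrow> 'i set) \<Rightarrow> ('i \<Rightarrow> 'w \<Rightarrow> real) \<Rightarrow> ('l \<Rightarrow> 'i \<Rightarrow> 'w \<Rightarrow> real) \<Rightarrow>
     's set \<Rightarrow> (('i \<Rightarrow> real) \<Rightarrow> 's \<Rightarrow> real) \<Rightarrow> 'l set \<Rightarrow> 'w \<Rightarrow> 's set" where
  "perturbed_optimizers I J X Y S H A \<omega> =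
     (\<lambda>l. arg_min_on (H (perturbed_input I (J l) X (Y l) \<omega>)) S) ` A"

text \<open>The \<open>n\<close>-th problem is to minimize \<open>H n x\<close> over \<open>S n\<close>, where the input \<open>x\<close> is the random
  vector \<open>X n\<close> with coordinates in \<open>I n\<close> on the probability space \<open>M n\<close>; \<open>d n\<close> is the metric on
  \<open>S n\<close>, the blocks are \<open>J n l\<close> for \<open>l \<in> L n\<close>, and \<open>Y n l\<close> is the copy of \<open>X n\<close> used to
  resample block \<open>l\<close>. If \<open>L n\<close> is empty, then \<open>Min\<close> is applied to an empty set for \<open>\<epsilon> \<le> 1\<close>;
  this is harmless if it happens only for finitely many \<open>n\<close>.\<close>

definition stable_under_small_perturbations ::
    "(nat \<Rightarrow> 'w measure) \<Rightarrow> (nat \<Rightarrow> 'i set) \<Rightarrow>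
     (nat \<Rightarrow> 'i \<Rightarrow> 'w \<Rightarrow> real) \<Rightarrow> (nat \<Rightarrow> 'l \<Rightarrow> 'i \<Rightarrow> 'w \<Rightarrow> real) \<Rightarrow>
     (nat \<Rightarrow> 's set) \<Rightarrow> (nat \<Rightarrow> 's \<Rightarrow> 's \<Rightarrow> real) \<Rightarrow> (nat \<Rightarrow> ('i \<Rightarrow> real) \<Rightarrow> 's \<Rightarrow> real) \<Rightarrow>
     (nat \<Rightarrow> 'l set) \<Rightarrow> (nat \<Rightarrow> 'l \<Rightarrow> 'i set) \<Rightarrow> bool" where
  "stable_under_small_perturbations M I X Y S d H L J \<longleftrightarrow>
     (\<forall>n. perturbation_blocks (I n) (L n) (J n)) \<and>
     (\<forall>\<epsilon>>0. \<forall>\<delta>>0. \<exists>K::real.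
        limsup (\<lambda>n. ereal (\<P>(\<omega> in M n.
          real (Min {packing_number (perturbed_optimizers (I n) (J n) (X n) (Y n) (S n) (H n) A \<omega>)
                       (d n) \<epsilon>
                     | A. A \<subseteq> L n \<and> real (card A) > (1 - \<epsilon>) * real (card (L n))}) \<ge> K)))
        \<le> ereal \<delta>)"

definition edges :: "nat \<Rightarrow> (nat \<times> nat) set" where
  "edges n = {(i, j). 1 \<le> i \<and> i < j \<and> j \<le> n}"

definition spins :: "nat \<Rightarrow> (nat \<Rightarrow> real) set" where
  "spins n = {\<sigma> \<in> {1..n} \<rightarrow>\<^sub>E {1, -1}. \<sigma> 1 = 1}"

definition hamming :: "nat \<Rightarrow> (nat \<Rightarrow> real) \<Rightarrow> (nat \<Rightarrow> real) \<Rightarrow> real" where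
  "hamming n \<sigma> \<tau> = real (card {i \<in> {1..n}. \<sigma> i \<noteq> \<tau> i}) / real n"

definition sk_hamiltonian :: "nat \<Rightarrow> (nat \<times> nat \<Rightarrow> real) \<Rightarrow> (nat \<Rightarrow> real) \<Rightarrow> real" where
  "sk_hamiltonian n x \<sigma> = - (\<Sum>(i, j)\<in>edges n. x (i, j) * \<sigma> i * \<sigma> j)"

end

(* Let g(x) be the maximum of -H(x; .) over the spin configurations and W standard Gaussian noise.
   For a density f, the function (g(x + s w) - g(x)) min (f x) (f (x + s w)) is odd under the
   measure preserving involution (x, w) -> (x + s w, -w); the remaining part of the increment is
   controlled by the rejection assumption. Hence noise of size s in one coordinate raises the
   expectation of a 1-Lipschitz function by at most C s^2, and noise of size 1/n in all couplings
   raises E g by at most C. If, on the other hand, there are many separated configurations within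
   a constant of the maximum, then the best of them gains much from the noise, by a Sudakov
   minoration that is proved here with softmax weights and Gaussian integration by parts. So with
   high probability there are few separated near-maximizers. Resampling an edge whose two
   couplings are bounded by R moves energies by at most 2 R, so its optimizer is within 4 R of the
   maximum, and by Markov's inequality all but a small fraction of the edges are of this kind. *)
theory Submission
  imports Defs "HOL-Real_Asymp.Real_Asymp"
begin

section \<open>Gaussian integration by parts\<close>

text \<open>Noise of size 1/n perturbs each energy by a Gaussian of variance
  \<open>card (edges n) / n\<^sup>2\<close>, at most 1, so K separated configurations gain an amount
  of order sqrt(log K), uniformly in n. The Lipschitz property alone would only bound the rise of
  the expected maximum by order n, from about n^2 coordinates at cost 1/n each, which would swamp
  this gain. The second order cost per coordinate brings the total down to a constant, and this is
  why the final threshold can be independent of n. No concentration of the maximum is required.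
  Where near-maximizers are few, noise still cannot lower the expected maximum, so the probability
  of the bad event times the gain on it is at most the total cost. The obstacle is that the energy
  depends only on the products of spins, which identify a configuration with its negative. Two
  configurations that are far apart in the Hamming metric may have almost equal products when they
  are nearly antipodal. The minoration is therefore proved in a form that tolerates two points in
  each ball.\<close>

abbreviation std_gauss :: "real measure" where
  "std_gauss \<equiv> density lborel std_normal_density"

lemma prob_space_std_gauss: "prob_space std_gauss"
  by (rule prob_space_normal_density) simp

text \<open>The difference of the two integrands is, up to sign, the derivative of
  \<open>std_normal_density x * h x\<close>, since the density has derivative \<open>- x\<close>
  times itself. That product vanishes at both ends of the line because \<open>h\<close> is
  bounded.\<close>

lemma std_gauss_stein:
  fixes h h' :: "real \<Rightarrow> real"
  assumes h: "\<And>x. (h has_real_derivative h' x) (at x)"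
    and cont: "continuous_on UNIV h'"
    and B: "\<And>x. \<bar>h x\<bar> \<le> B" and B': "\<And>x. \<bar>h' x\<bar> \<le> B'"
  shows "(\<integral>x. x * h x \<partial>std_gauss) = (\<integral>x. h' x \<partial>std_gauss)"
proof -
  have conth: "continuous_on UNIV h"
    using h by (auto simp: continuous_on_eq_continuous_at intro: DERIV_isCont)
  have mh[measurable]: "h \<in> borel_measurable borel" "h' \<in> borel_measurable borel"
    using conth cont by (auto intro: borel_measurable_continuous_onI)
  define F where "F x = std_normal_density x * h x" for x
  define G where "G x = std_normal_density x * h' x - std_normal_density x * (x * h x)" for x
  have i1: "integrable lborel (\<lambda>x. std_normal_density x * h' x)"
    by (rule Bochner_Integration.integrable_bound[of _ "\<lambda>x. std_normal_density x * B'"])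
       (use B' in \<open>auto simp: abs_mult intro!: mult_left_mono AE_I2 order_trans[OF B' abs_ge_self]\<close>)
  have i2: "integrable lborel (\<lambda>x. std_normal_density x * (x * h x))"
  proof (rule Bochner_Integration.integrable_bound)
    show "integrable lborel (\<lambda>x. std_normal_density x * \<bar>x\<bar> ^ 1 * B)"
      by (intro integrable_mult_left integrable_std_normal_moment_abs)
    show "AE x in lborel. norm (std_normal_density x * (x * h x)) \<le> norm (std_normal_density x * \<bar>x\<bar> ^ 1 * B)"
      by (intro AE_I2) (auto simp: abs_mult mult.assoc intro!: mult_left_mono order_trans[OF B])
  qed simp
  have der: "(F has_real_derivative G x) (at x)" for x
  proof -
    \<comment> \<open>Hiding the normalising constant behind \<open>c\<close> leaves a plain
      exponential to differentiate.\<close>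
    obtain c where c: "std_normal_density = (\<lambda>x. c * exp (- x\<^sup>2 / 2))"
      using std_normal_density_def by fast
    have "(std_normal_density has_real_derivative - x * std_normal_density x) (at x)"
      unfolding c by (auto intro!: derivative_eq_intros)
    from DERIV_mult[OF this h[of x]] show ?thesis
      unfolding F_def G_def by (simp add: algebra_simps)
  qed
  have lim: "(std_normal_density \<longlongrightarrow> 0) at_top" "(std_normal_density \<longlongrightarrow> 0) at_bot"
    unfolding std_normal_density_def by real_asymp+
  have limF: "(F \<longlongrightarrow> 0) A" if "(std_normal_density \<longlongrightarrow> 0) A" for A
  proof (rule Lim_null_comparison)
    show "\<forall>\<^sub>F x in A. norm (F x) \<le> std_normal_density x * B"
      using B by (auto simp: F_def abs_mult intro!: mult_left_mono eventuallyI)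
    show "((\<lambda>x. std_normal_density x * B) \<longlongrightarrow> 0) A"
      using tendsto_mult[OF that tendsto_const[of B]] by simp
  qed
  have contG: "isCont G x" for x
  proof -
    obtain c where c: "std_normal_density = (\<lambda>x. c * exp (- x\<^sup>2 / 2))"
      using std_normal_density_def by fast
    have "isCont h x" "isCont h' x" "isCont std_normal_density x"
      using conth cont unfolding c by (auto simp: continuous_on_eq_continuous_at)
    then show ?thesis unfolding G_def by (intro continuous_intros)
  qed
  have "(LBINT x=-\<infinity>..\<infinity>. G x) = 0 - 0"
  proof (rule interval_integral_FTC_integrable)
    show "set_integrable lborel (einterval (- \<infinity>) \<infinity>) G"
      using i1 i2 by (auto simp: G_def[abs_def] set_integrable_def)
    show "((F \<circ> real_of_ereal) \<longlongrightarrow> 0) (at_right (-\<infinity>))"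
      using limF[OF lim(2)] by (simp add: at_right_MInf filtermap_filtermap comp_def filterlim_def)
    show "((F \<circ> real_of_ereal) \<longlongrightarrow> 0) (at_left \<infinity>)"
      using limF[OF lim(1)] by (simp add: at_left_PInf filtermap_filtermap comp_def filterlim_def)
  qed (use der contG in \<open>auto simp: has_real_derivative_iff_has_vector_derivative\<close>)
  then have "(\<integral>x. G x \<partial>lborel) = 0"
    by (simp add: interval_lebesgue_integral_def set_lebesgue_integral_def)
  then have "(\<integral>x. std_normal_density x * h' x \<partial>lborel) = (\<integral>x. std_normal_density x * (x * h x) \<partial>lborel)"
    unfolding G_def using i1 i2 by (simp add: Bochner_Integration.integral_diff)
  then show ?thesis
    by (simp add: integral_density)
qed

lemma integrable_std_gauss_abs: "integrable std_gauss (\<lambda>x. \<bar>x\<bar>)"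
  using integrable_std_normal_moment_abs[of 1] by (subst integrable_density) auto

lemma integrable_std_gauss_ident: "integrable std_gauss (\<lambda>x. x)"
  using integrable_std_normal_moment[of 1] by (subst integrable_density) auto

lemma integral_std_gauss_ident: "(\<integral>x. x \<partial>std_gauss) = 0"
  using integral_std_normal_moment_odd[of 0] by (subst integral_density) auto

text \<open>Completing the square turns the integrand into a multiple of the normal density with
  mean \<open>a\<close>.\<close>

lemma std_gauss_mgf:
  shows "integrable std_gauss (\<lambda>x. exp (a * x))"
    and "(\<integral>x. exp (a * x) \<partial>std_gauss) = exp (a\<^sup>2 / 2)"
proof -
  have eq: "std_normal_density x * exp (a * x) = exp (a\<^sup>2 / 2) * normal_density a 1 x" for x
    by (simp add: normal_density_def mult_exp_exp field_simps power2_eq_square)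
  show "integrable std_gauss (\<lambda>x. exp (a * x))"
    by (subst integrable_density) (auto simp: eq)
  show "(\<integral>x. exp (a * x) \<partial>std_gauss) = exp (a\<^sup>2 / 2)"
    by (subst integral_density) (auto simp: eq)
qed

section \<open>Finitely many independent coordinates\<close>

lemma product_prob_space_const: "prob_space Q \<Longrightarrow> product_prob_space (\<lambda>_. Q)"
  by (simp add: product_prob_spaceI)

lemma integrable_PiM_component:
  fixes f :: "real \<Rightarrow> real"
  assumes "prob_space Q" "integrable Q f" "e \<in> I"
  shows "integrable (PiM I (\<lambda>_. Q)) (\<lambda>x. f (x e))"
proof -
  have "integrable (distr (PiM I (\<lambda>_. Q)) Q (\<lambda>x. x e)) f"
    using assms by (subst distr_PiM_component) auto
  then show ?thesis
    using assms by (subst (asm) integrable_distr_eq) auto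
qed

lemma integral_PiM_component:
  fixes f :: "real \<Rightarrow> real"
  assumes "prob_space Q" "f \<in> borel_measurable Q" "e \<in> I"
  shows "(\<integral>x. f (x e) \<partial>PiM I (\<lambda>_. Q)) = integral\<^sup>L Q f"
proof -
  have "integral\<^sup>L Q f = integral\<^sup>L (distr (PiM I (\<lambda>_. Q)) Q (\<lambda>x. x e)) f"
    using assms by (subst distr_PiM_component) auto
  then show ?thesis
    using assms by (subst (asm) integral_distr) auto
qed

text \<open>Fubini in the coordinate \<open>e\<close>: with the others frozen, the one-dimensional
  identity applies on each fibre. Boundedness of \<open>h\<close> and \<open>h'\<close> supplies the
  integrability that Fubini asks for.\<close>

lemma PiM_std_gauss_stein:
  fixes h h' :: "('i \<Rightarrow> real) \<Rightarrow> real"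
  assumes I: "finite I" "e \<in> I"
    and mh: "h \<in> borel_measurable (PiM I (\<lambda>_. borel))"
    and mh': "h' \<in> borel_measurable (PiM I (\<lambda>_. borel))"
    and der: "\<And>w x. ((\<lambda>y. h (w(e := y))) has_real_derivative h' (w(e := x))) (at x)"
    and cont: "\<And>w. continuous_on UNIV (\<lambda>x. h' (w(e := x)))"
    and B: "\<And>w. \<bar>h w\<bar> \<le> B" and B': "\<And>w. \<bar>h' w\<bar> \<le> B'"
  shows "integrable (PiM I (\<lambda>_. std_gauss)) (\<lambda>w. w e * h w)"
    and "integrable (PiM I (\<lambda>_. std_gauss)) h'"
    and "(\<integral>w. w e * h w \<partial>PiM I (\<lambda>_. std_gauss)) = (\<integral>w. h' w \<partial>PiM I (\<lambda>_. std_gauss))"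
proof -
  interpret product_prob_space "\<lambda>_::'i. std_gauss"
    by (rule product_prob_space_const[OF prob_space_std_gauss])
  have [measurable_cong]: "sets (PiM I (\<lambda>_. std_gauss)) = sets (PiM I (\<lambda>_. borel))"
    by (intro sets_PiM_cong) auto
  note mh[measurable] mh'[measurable]
  have Ii: "I = insert e (I - {e})" using I by auto
  show 1: "integrable (PiM I (\<lambda>_. std_gauss)) (\<lambda>w. w e * h w)"
  proof (rule Bochner_Integration.integrable_bound)
    show "integrable (PiM I (\<lambda>_. std_gauss)) (\<lambda>w. \<bar>w e\<bar> * B)"
      using integrable_PiM_component[OF prob_space_std_gauss integrable_std_gauss_abs I(2)] by simp
    have "\<bar>w e\<bar> * \<bar>h w\<bar> \<le> \<bar>w e\<bar> * \<bar>B\<bar>" for w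
      by (intro mult_left_mono order_trans[OF B]) auto
    then show "AE w in PiM I (\<lambda>_. std_gauss). norm (w e * h w) \<le> norm (\<bar>w e\<bar> * B)"
      by (auto simp: abs_mult)
    have "(\<lambda>w. w e) \<in> borel_measurable (PiM I (\<lambda>_. borel))" using I by measurable
    then have "(\<lambda>w. w e) \<in> borel_measurable (PiM I (\<lambda>_. std_gauss))" by measurable
    then show "(\<lambda>w. w e * h w) \<in> borel_measurable (PiM I (\<lambda>_. std_gauss))" by measurable
  qed
  have PP: "prob_space (PiM I (\<lambda>_. std_gauss))"
    by (intro prob_space_PiM prob_space_std_gauss)
  show 2: "integrable (PiM I (\<lambda>_. std_gauss)) h'"
    using B' by (intro finite_measure.integrable_const_bound[of _ _ B'] prob_space.finite_measure PP) auto
  have "(\<integral>x. (w(e := x)) e * h (w(e := x)) \<partial>std_gauss) = (\<integral>x. h' (w(e := x)) \<partial>std_gauss)" for w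
    using std_gauss_stein[OF der cont B B'] by simp
  then show "(\<integral>w. w e * h w \<partial>PiM I (\<lambda>_. std_gauss)) = (\<integral>w. h' w \<partial>PiM I (\<lambda>_. std_gauss))"
    using product_integral_insert[of "I - {e}" e "\<lambda>w. w e * h w", folded Ii]
      product_integral_insert[of "I - {e}" e h', folded Ii] I 1 2
    by simp
qed

lemma PiM_std_gauss_mgf:
  assumes "finite I"
  shows "integrable (PiM I (\<lambda>_. std_gauss)) (\<lambda>w. exp (\<Sum>e\<in>I. a e * w e))"
    and "(\<integral>w. exp (\<Sum>e\<in>I. a e * w e) \<partial>PiM I (\<lambda>_. std_gauss)) = exp ((\<Sum>e\<in>I. (a e)\<^sup>2) / 2)"
proof -
  interpret product_prob_space "\<lambda>_::'a. std_gauss"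
    by (rule product_prob_space_const[OF prob_space_std_gauss])
  show "integrable (PiM I (\<lambda>_. std_gauss)) (\<lambda>w. exp (\<Sum>e\<in>I. a e * w e))"
    unfolding exp_sum[OF assms] using assms std_gauss_mgf(1)
    by (intro product_integrable_prod[of I "\<lambda>e x. exp (a e * x)"]) auto
  show "(\<integral>w. exp (\<Sum>e\<in>I. a e * w e) \<partial>PiM I (\<lambda>_. std_gauss)) = exp ((\<Sum>e\<in>I. (a e)\<^sup>2) / 2)"
    unfolding exp_sum[OF assms] using assms std_gauss_mgf
    by (subst product_integral_prod[of I "\<lambda>e x. exp (a e * x)"]) (auto simp: exp_sum sum_divide_distrib)
qed

section \<open>Expected maximum of separated Gaussian variables\<close>

definition lin :: "'i set \<Rightarrow> ('i \<Rightarrow> real) \<Rightarrow> ('i \<Rightarrow> real) \<Rightarrow> real" where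
  "lin I v w = (\<Sum>e\<in>I. v e * w e)"

text \<open>The Gibbs weight of \<open>t\<close> at inverse temperature \<open>l\<close>: a smooth
  substitute for selecting the maximizer, so that integration by parts is available.\<close>

definition softmax ::
    "'i set \<Rightarrow> 't set \<Rightarrow> ('t \<Rightarrow> 'i \<Rightarrow> real) \<Rightarrow> real \<Rightarrow> 't \<Rightarrow> ('i \<Rightarrow> real) \<Rightarrow> real" where
  "softmax I T v l t w = exp (l * lin I (v t) w) / (\<Sum>s\<in>T. exp (l * lin I (v s) w))"

lemma measurable_lin[measurable]:
  "finite I \<Longrightarrow> lin I v \<in> borel_measurable (PiM I (\<lambda>_. borel))"
  unfolding lin_def by measurable

lemma measurable_softmax[measurable]:
  "finite I \<Longrightarrow> finite T \<Longrightarrow> softmax I T v l t \<in> borel_measurable (PiM I (\<lambda>_. borel))"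
  unfolding softmax_def by measurable

lemma lin_upd:
  assumes "finite I" "e \<in> I"
  shows "lin I v (w(e := x)) = lin (I - {e}) v w + v e * x"
  unfolding lin_def using assms
  by (subst sum.remove[of _ e]) (auto intro!: sum.cong)

context
  fixes I :: "'i set" and T :: "'t set" and v :: "'t \<Rightarrow> 'i \<Rightarrow> real" and l :: real
  assumes fin: "finite I" "finite T" "T \<noteq> {}"
begin

private abbreviation "p \<equiv> softmax I T v l"

lemma softmax_denominator_pos: "(\<Sum>s\<in>T. exp (l * lin I (v s) w)) > 0"
  using fin by (intro sum_pos) auto

lemma softmax_nonneg: "p t w \<ge> 0"
  unfolding softmax_def using softmax_denominator_pos[of w] by simp

lemma softmax_sum: "(\<Sum>t\<in>T. p t w) = 1"
  unfolding softmax_def using softmax_denominator_pos[of w] by (simp flip: sum_divide_distrib)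

lemma softmax_le_1: "t \<in> T \<Longrightarrow> p t w \<le> 1"
  using member_le_sum[of t T "\<lambda>t. p t w"] softmax_nonneg softmax_sum[of w] fin by auto

text \<open>The quotient rule, arranged so that the deviation of \<open>v t e\<close> from its Gibbs
  average appears; summed against \<open>v t e\<close> this becomes a variance.\<close>

lemma softmax_derivative:
  assumes e: "e \<in> I"
  shows "((\<lambda>y. p t (w(e := y))) has_real_derivative
     l * p t (w(e := x)) * (v t e - (\<Sum>s\<in>T. p s (w(e := x)) * v s e))) (at x)"
proof -
  define D where "D y = (\<Sum>s\<in>T. exp (l * (lin (I - {e}) (v s) w + v s e * y)))" for y
  have D: "D y > 0" for y
    unfolding D_def using fin by (intro sum_pos) auto
  have eq: "p t (w(e := y)) = exp (l * (lin (I - {e}) (v t) w + v t e * y)) / D y" for t y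
    unfolding softmax_def D_def using lin_upd[OF fin(1) e] by simp
  have dD: "(D has_real_derivative (\<Sum>s\<in>T. exp (l * (lin (I - {e}) (v s) w + v s e * x)) * (l * v s e))) (at x)"
    unfolding D_def by (auto intro!: derivative_eq_intros sum.cong)
  have S: "(\<Sum>s\<in>T. exp (l * (lin (I - {e}) (v s) w + v s e * x)) * (l * v s e))
      = l * D x * (\<Sum>s\<in>T. p s (w(e := x)) * v s e)"
    unfolding eq sum_distrib_left using D[of x] by (intro sum.cong) (auto simp: field_simps)
  have "((\<lambda>y. exp (l * (lin (I - {e}) (v t) w + v t e * y)) / D y) has_real_derivative
     (exp (l * (lin (I - {e}) (v t) w + v t e * x)) * (l * v t e) * D x
      - exp (l * (lin (I - {e}) (v t) w + v t e * x)) * (l * D x * (\<Sum>s\<in>T. p s (w(e := x)) * v s e))) / (D x * D x)) (at x)"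
    using D[of x] dD[unfolded S] by (auto intro!: derivative_eq_intros)
  moreover have "(exp (l * (lin (I - {e}) (v t) w + v t e * x)) * (l * v t e) * D x
      - exp (l * (lin (I - {e}) (v t) w + v t e * x)) * (l * D x * (\<Sum>s\<in>T. p s (w(e := x)) * v s e))) / (D x * D x)
    = l * p t (w(e := x)) * (v t e - (\<Sum>s\<in>T. p s (w(e := x)) * v s e))"
    unfolding eq[of t] using D[of x] by (simp add: divide_simps) (simp add: algebra_simps)
  ultimately show ?thesis
    unfolding eq[of t] by simp
qed

lemma sum_abs_softmax_le:
  assumes "\<And>s. s \<in> T \<Longrightarrow> \<bar>u s\<bar> \<le> B"
  shows "\<bar>\<Sum>s\<in>T. p s w * u s\<bar> \<le> B"
proof -
  have "\<bar>\<Sum>s\<in>T. p s w * u s\<bar> \<le> (\<Sum>s\<in>T. \<bar>p s w * u s\<bar>)" by (rule sum_abs)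
  also have "\<dots> \<le> (\<Sum>s\<in>T. p s w * B)"
    using assms softmax_nonneg by (intro sum_mono) (auto simp: abs_mult intro!: mult_left_mono)
  also have "\<dots> = B" using softmax_sum[of w] by (simp flip: sum_distrib_right)
  finally show ?thesis .
qed

text \<open>In each coordinate this is the variance of \<open>v t e\<close> under the Gibbs weights,
  which equals half the mean squared difference of two independent draws.\<close>

lemma softmax_gain_pointwise:
  "(\<Sum>t\<in>T. \<Sum>e\<in>I. v t e * (p t w * (v t e - (\<Sum>s\<in>T. p s w * v s e))))
   = (\<Sum>t\<in>T. \<Sum>s\<in>T. p t w * p s w * (\<Sum>e\<in>I. (v t e - v s e)\<^sup>2)) / 2"
proof -
  have e: "(\<Sum>t\<in>T. v t e * (p t w * (v t e - (\<Sum>s\<in>T. p s w * v s e))))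
     = (\<Sum>t\<in>T. \<Sum>s\<in>T. p t w * p s w * (v t e - v s e)\<^sup>2) / 2" for e
  proof -
    let ?A = "\<Sum>t\<in>T. p t w * (v t e)\<^sup>2" and ?m = "\<Sum>s\<in>T. p s w * v s e"
    have "(\<Sum>t\<in>T. \<Sum>s\<in>T. p t w * p s w * (v t e - v s e)\<^sup>2)
       = (\<Sum>t\<in>T. \<Sum>s\<in>T. p t w * (v t e)\<^sup>2 * p s w + p t w * (p s w * (v s e)\<^sup>2) - 2 * (p t w * v t e) * (p s w * v s e))"
      by (intro sum.cong refl) (simp add: power2_eq_square algebra_simps)
    also have "\<dots> = ?A * 1 + 1 * ?A - 2 * (?m * ?m)"
      by (simp add: sum.distrib sum_subtractf softmax_sum flip: sum_distrib_left sum_distrib_right)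
    finally have 1: "(\<Sum>t\<in>T. \<Sum>s\<in>T. p t w * p s w * (v t e - v s e)\<^sup>2) = 2 * (?A - ?m * ?m)"
      by simp
    have "(\<Sum>t\<in>T. v t e * (p t w * (v t e - ?m))) = (\<Sum>t\<in>T. p t w * (v t e)\<^sup>2 - p t w * v t e * ?m)"
      by (intro sum.cong refl) (simp add: power2_eq_square algebra_simps)
    also have "\<dots> = ?A - ?m * ?m"
      by (simp add: sum_subtractf flip: sum_distrib_right)
    finally show ?thesis using 1 by simp
  qed
  have "(\<Sum>t\<in>T. \<Sum>e\<in>I. v t e * (p t w * (v t e - (\<Sum>s\<in>T. p s w * v s e))))
     = (\<Sum>e\<in>I. \<Sum>t\<in>T. v t e * (p t w * (v t e - (\<Sum>s\<in>T. p s w * v s e))))"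
    by (rule sum.swap)
  also have "\<dots> = (\<Sum>e\<in>I. \<Sum>t\<in>T. \<Sum>s\<in>T. p t w * p s w * (v t e - v s e)\<^sup>2) / 2"
    unfolding e by (simp add: sum_divide_distrib)
  also have "(\<Sum>e\<in>I. \<Sum>t\<in>T. \<Sum>s\<in>T. p t w * p s w * (v t e - v s e)\<^sup>2)
     = (\<Sum>t\<in>T. \<Sum>s\<in>T. p t w * p s w * (\<Sum>e\<in>I. (v t e - v s e)\<^sup>2))"
    by (subst sum.swap, intro sum.cong refl, subst sum.swap) (simp add: sum_distrib_left)
  finally show ?thesis .
qed

text \<open>Pairs at distance at least \<open>a\<close> contribute at least \<open>a\<close> times
  their weight. The weight of the remaining pairs is small: \<open>p t w * p s w\<close> is at most
  the mean of the two squares, and each point has at most two close ones, itself included.\<close>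

lemma softmax_pairs_lower_bound:
  assumes a: "a \<ge> 0"
    and near: "\<And>t. t \<in> T \<Longrightarrow> card {s \<in> T. d t s < a} \<le> 2"
    and sym: "\<And>s t. d s t = d t s" and nn: "\<And>s t. d s t \<ge> 0"
  shows "(\<Sum>t\<in>T. \<Sum>s\<in>T. p t w * p s w * d t s) \<ge> a * (1 - 2 * (\<Sum>t\<in>T. (p t w)\<^sup>2))"
proof -
  let ?n = "\<lambda>t s. if d t s < a then 1 else (0::real)"
  have "(\<Sum>t\<in>T. \<Sum>s\<in>T. ?n t s * (p t w * p s w)) \<le> (\<Sum>t\<in>T. \<Sum>s\<in>T. ?n t s * ((p t w)\<^sup>2 / 2 + (p s w)\<^sup>2 / 2))"
  proof (intro sum_mono mult_left_mono)
    fix s t show "p t w * p s w \<le> (p t w)\<^sup>2 / 2 + (p s w)\<^sup>2 / 2"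
      using sum_squares_bound[of "p t w" "p s w"] by simp
  qed auto
  also have "\<dots> = (\<Sum>t\<in>T. \<Sum>s\<in>T. ?n t s * ((p t w)\<^sup>2 / 2)) + (\<Sum>t\<in>T. \<Sum>s\<in>T. ?n t s * ((p s w)\<^sup>2 / 2))"
    by (simp add: sum.distrib distrib_left)
  \<comment> \<open>Closeness is symmetric, so exchanging the two summation variables identifies the
    halves.\<close>
  also have "(\<Sum>t\<in>T. \<Sum>s\<in>T. ?n t s * ((p s w)\<^sup>2 / 2)) = (\<Sum>t\<in>T. \<Sum>s\<in>T. ?n t s * ((p t w)\<^sup>2 / 2))"
    unfolding sum.swap[of "\<lambda>t s. ?n t s * ((p s w)\<^sup>2 / 2)"]
    by (intro sum.cong refl arg_cong2[where f="(*)"]) (metis sym)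
  also have "(\<Sum>t\<in>T. \<Sum>s\<in>T. ?n t s * ((p t w)\<^sup>2 / 2)) = (\<Sum>t\<in>T. real (card {s\<in>T. d t s < a}) * ((p t w)\<^sup>2 / 2))"
  proof (intro sum.cong refl)
    fix t
    have "(\<Sum>s\<in>T. ?n t s) = real (card {s \<in> T. d t s < a})"
      using fin by (simp add: sum.If_cases Int_def)
    then show "(\<Sum>s\<in>T. ?n t s * ((p t w)\<^sup>2 / 2)) = real (card {s\<in>T. d t s < a}) * ((p t w)\<^sup>2 / 2)"
      unfolding sum_distrib_right[symmetric] by simp
  qed
  also have "\<dots> \<le> (\<Sum>t\<in>T. 2 * ((p t w)\<^sup>2 / 2))"
  proof (intro sum_mono mult_right_mono)
    fix t assume "t \<in> T"
    from near[OF this] show "real (card {s \<in> T. d t s < a}) \<le> 2" by linarith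
  qed auto
  finally have 1: "(\<Sum>t\<in>T. \<Sum>s\<in>T. ?n t s * (p t w * p s w)) \<le> 2 * (\<Sum>t\<in>T. (p t w)\<^sup>2)"
    by (simp add: sum_distrib_left)
  have total: "(\<Sum>t\<in>T. \<Sum>s\<in>T. p t w * p s w) = 1"
    by (simp add: softmax_sum flip: sum_distrib_left)
  have "a * (1 - 2 * (\<Sum>t\<in>T. (p t w)\<^sup>2)) \<le> a * (1 - (\<Sum>t\<in>T. \<Sum>s\<in>T. ?n t s * (p t w * p s w)))"
    using 1 a by (intro mult_left_mono) auto
  also have "\<dots> = a * ((\<Sum>t\<in>T. \<Sum>s\<in>T. p t w * p s w) - (\<Sum>t\<in>T. \<Sum>s\<in>T. ?n t s * (p t w * p s w)))"
    using total by simp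
  also have "a * ((\<Sum>t\<in>T. \<Sum>s\<in>T. p t w * p s w) - (\<Sum>t\<in>T. \<Sum>s\<in>T. ?n t s * (p t w * p s w)))
     = (\<Sum>t\<in>T. \<Sum>s\<in>T. p t w * p s w * (a * (1 - ?n t s)))"
    unfolding sum_subtractf[symmetric] sum_distrib_left
    by (intro sum.cong refl) (simp add: algebra_simps)
  also have "\<dots> \<le> (\<Sum>t\<in>T. \<Sum>s\<in>T. p t w * p s w * d t s)"
    using softmax_nonneg nn by (intro sum_mono mult_left_mono) auto
  finally show ?thesis .
qed

text \<open>The squared normalising sum stands in the denominator, where its Gaussian expectation is
  out of reach. Bounding its inverse by a mean of inverse squares leaves only exponentials of linear
  forms, whose expectations are explicit.\<close>

lemma softmax_sum_squares_le:
  "(\<Sum>t\<in>T. (p t w)\<^sup>2) \<le> (\<Sum>t\<in>T. \<Sum>s\<in>T. exp (\<Sum>e\<in>I. (2 * l * (v t e - v s e)) * w e)) / real (card T) ^ 3"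
proof -
  define y where "y t = exp (l * lin I (v t) w)" for t
  have y: "y t > 0" for t by (simp add: y_def)
  define K where "K = real (card T)"
  have K: "K > 0" using fin by (simp add: K_def card_gt_0_iff)
  define S where "S = (\<Sum>t\<in>T. y t)"
  have S: "S > 0" using softmax_denominator_pos[of w] by (simp add: S_def y_def)
  \<comment> \<open>Comparison of arithmetic and harmonic means, obtained from
    Cauchy-Schwarz.\<close>
  have "(\<Sum>t\<in>T. sqrt (y t) * (1 / sqrt (y t)))\<^sup>2 \<le> (\<Sum>t\<in>T. (sqrt (y t))\<^sup>2) * (\<Sum>t\<in>T. (1 / sqrt (y t))\<^sup>2)"
    by (rule Cauchy_Schwarz_ineq_sum)
  then have 1: "K\<^sup>2 \<le> S * (\<Sum>t\<in>T. 1 / y t)"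
  proof -
    have "sqrt (y t) * (1 / sqrt (y t)) = 1" "(sqrt (y t))\<^sup>2 = y t" "(1 / sqrt (y t))\<^sup>2 = 1 / y t" for t
      using y[of t] by (auto simp: power_divide)
    then show ?thesis
      using \<open>(\<Sum>t\<in>T. sqrt (y t) * (1 / sqrt (y t)))\<^sup>2 \<le> _\<close> by (simp add: K_def S_def)
  qed
  \<comment> \<open>A second Cauchy-Schwarz passes from inverses to inverse squares, so that the
    ratios \<open>(y t)\<^sup>2 / (y s)\<^sup>2\<close> arise.\<close>
  have "(\<Sum>t\<in>T. 1 * (1 / y t))\<^sup>2 \<le> (\<Sum>t\<in>T. 1\<^sup>2) * (\<Sum>t\<in>T. (1 / y t)\<^sup>2)"
    by (rule Cauchy_Schwarz_ineq_sum)
  then have 2: "(\<Sum>t\<in>T. 1 / y t)\<^sup>2 \<le> K * (\<Sum>t\<in>T. 1 / (y t)\<^sup>2)"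
    by (simp add: K_def power_divide)
  have "(K\<^sup>2)\<^sup>2 \<le> (S * (\<Sum>t\<in>T. 1 / y t))\<^sup>2"
    using 1 by (intro power_mono) auto
  also have "\<dots> \<le> S\<^sup>2 * (K * (\<Sum>t\<in>T. 1 / (y t)\<^sup>2))"
    unfolding power_mult_distrib using 2 by (intro mult_left_mono) auto
  finally have "K * K ^ 3 \<le> K * (S\<^sup>2 * (\<Sum>t\<in>T. 1 / (y t)\<^sup>2))"
    by (simp add: power2_eq_square power3_eq_cube algebra_simps)
  then have 3: "K ^ 3 \<le> S\<^sup>2 * (\<Sum>s\<in>T. 1 / (y s)\<^sup>2)"
    using K by simp
  have "1 / S\<^sup>2 \<le> (\<Sum>s\<in>T. 1 / (y s)\<^sup>2) / K ^ 3"
    using 3 K S by (simp add: field_simps)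
  then have "(\<Sum>t\<in>T. (y t)\<^sup>2) * (1 / S\<^sup>2) \<le> (\<Sum>t\<in>T. (y t)\<^sup>2) * ((\<Sum>s\<in>T. 1 / (y s)\<^sup>2) / K ^ 3)"
    by (intro mult_left_mono sum_nonneg) auto
  also have "\<dots> = (\<Sum>t\<in>T. \<Sum>s\<in>T. (y t)\<^sup>2 / (y s)\<^sup>2) / K ^ 3"
    by (simp add: sum_product)
  also have "(\<lambda>t s. (y t)\<^sup>2 / (y s)\<^sup>2) = (\<lambda>t s. exp (\<Sum>e\<in>I. (2 * l * (v t e - v s e)) * w e))"
  proof (intro ext)
    fix t s
    have "(\<Sum>e\<in>I. (2 * l * (v t e - v s e)) * w e) = 2 * (l * lin I (v t) w) - 2 * (l * lin I (v s) w)"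
      unfolding lin_def sum_distrib_left sum_subtractf[symmetric] by (intro sum.cong) (auto simp: algebra_simps)
    then show "(y t)\<^sup>2 / (y s)\<^sup>2 = exp (\<Sum>e\<in>I. (2 * l * (v t e - v s e)) * w e)"
      by (simp add: y_def exp_diff exp_double)
  qed
  also have "(\<Sum>t\<in>T. (y t)\<^sup>2) * (1 / S\<^sup>2) = (\<Sum>t\<in>T. (p t w)\<^sup>2)"
    unfolding softmax_def S_def y_def[symmetric] by (simp add: power_divide sum_divide_distrib)
  finally show ?thesis by (simp add: K_def)
qed

end

text \<open>The maximum dominates the softmax average of the linear forms, and integration by parts
  turns the expectation of that average into \<open>l\<close> times an expected Gibbs variance. This
  is at least \<open>l * a / 2 * (1 - 2 * q)\<close>, where \<open>q\<close> is the expected sum of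
  squared weights; the hypothesis on the size of \<open>T\<close> forces
  \<open>q \<le> 1 / 4\<close>.\<close>

lemma expected_max_lower_bound:
  fixes I :: "'i set" and T :: "'t set" and v :: "'t \<Rightarrow> 'i \<Rightarrow> real"
  assumes fin: "finite I" "finite T" "T \<noteq> {}" and l: "l \<ge> 0" and a: "a \<ge> 0"
    and norm: "\<And>t. t \<in> T \<Longrightarrow> (\<Sum>e\<in>I. (v t e)\<^sup>2) \<le> 1"
    and near: "\<And>t. t \<in> T \<Longrightarrow> card {s \<in> T. (\<Sum>e\<in>I. (v t e - v s e)\<^sup>2) < a} \<le> 2"
    and size: "real (card T) \<ge> 4 * exp (8 * l\<^sup>2)"
  shows "integrable (PiM I (\<lambda>_. std_gauss)) (\<lambda>w. Max ((\<lambda>t. lin I (v t) w) ` T))"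
    and "(\<integral>w. Max ((\<lambda>t. lin I (v t) w) ` T) \<partial>PiM I (\<lambda>_. std_gauss)) \<ge> l * a / 4"
proof -
  let ?N = "PiM I (\<lambda>_. std_gauss)"
  let ?p = "softmax I T v l"
  let ?d = "\<lambda>t s. \<Sum>e\<in>I. (v t e - v s e)\<^sup>2"
  note F = fin
  have PN: "prob_space ?N" by (intro prob_space_PiM prob_space_std_gauss)
  have [measurable_cong]: "sets ?N = sets (PiM I (\<lambda>_. borel))"
    by (intro sets_PiM_cong) auto
  note [measurable] = measurable_lin[OF fin(1)] measurable_softmax[OF fin(1,2)]
  have int_w: "integrable ?N (\<lambda>w. w e)" if "e \<in> I" for e
    using integrable_PiM_component[OF prob_space_std_gauss integrable_std_gauss_ident that] .
  have int_lin: "integrable ?N (lin I u)" for u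
    unfolding lin_def using int_w by (intro Bochner_Integration.integrable_sum) auto
  show int_max: "integrable ?N (\<lambda>w. Max ((\<lambda>t. lin I (v t) w) ` T))"
  proof (rule Bochner_Integration.integrable_bound)
    show "integrable ?N (\<lambda>w. \<Sum>t\<in>T. \<bar>lin I (v t) w\<bar>)"
      using int_lin by (intro Bochner_Integration.integrable_sum integrable_abs) auto
    show "(\<lambda>w. Max ((\<lambda>t. lin I (v t) w) ` T)) \<in> borel_measurable ?N"
      using fin by (intro borel_measurable_Max) auto
    show "AE w in ?N. norm (Max ((\<lambda>t. lin I (v t) w) ` T)) \<le> norm (\<Sum>t\<in>T. \<bar>lin I (v t) w\<bar>)"
    proof (intro AE_I2)
      fix w
      have "Max ((\<lambda>t. lin I (v t) w) ` T) \<in> (\<lambda>t. lin I (v t) w) ` T"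
        using fin by (intro Max_in) auto
      then obtain t where t: "t \<in> T" "Max ((\<lambda>t. lin I (v t) w) ` T) = lin I (v t) w" by auto
      have "\<bar>lin I (v t) w\<bar> \<le> (\<Sum>t\<in>T. \<bar>lin I (v t) w\<bar>)"
        using t fin by (intro member_le_sum[of t T "\<lambda>t. \<bar>lin I (v t) w\<bar>"]) auto
      then show "norm (Max ((\<lambda>t. lin I (v t) w) ` T)) \<le> norm (\<Sum>t\<in>T. \<bar>lin I (v t) w\<bar>)"
        using t(2) by auto
    qed
  qed
  define D where "D t e w = l * ?p t w * (v t e - (\<Sum>s\<in>T. ?p s w * v s e))" for t e w
  have v_le: "\<bar>v t e\<bar> \<le> 1" if "t \<in> T" "e \<in> I" for t e
  proof -
    have "(v t e)\<^sup>2 \<le> 1"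
      using norm[OF that(1)] member_le_sum[of e I "\<lambda>e. (v t e)\<^sup>2"] fin that by auto
    then show ?thesis by (simp add: abs_square_le_1)
  qed
  have stein: "integrable ?N (\<lambda>w. w e * ?p t w)" "integrable ?N (D t e)"
      "(\<integral>w. w e * ?p t w \<partial>?N) = (\<integral>w. D t e w \<partial>?N)" if te: "t \<in> T" "e \<in> I" for t e
  proof -
    have der: "((\<lambda>y. ?p t (w(e := y))) has_real_derivative D t e (w(e := x))) (at x)" for w x
      unfolding D_def by (rule softmax_derivative[OF fin te(2)])
    have cont: "continuous_on UNIV (\<lambda>x. D t e (w(e := x)))" for w
    proof -
      have "continuous_on UNIV (\<lambda>x. ?p t (w(e := x)))" for t
        by (intro continuous_at_imp_continuous_on ballI, rule DERIV_isCont, rule softmax_derivative[OF fin te(2)])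
      then show ?thesis unfolding D_def by (intro continuous_intros)
    qed
    have B: "\<bar>?p t w\<bar> \<le> 1" for w
      using softmax_nonneg[OF fin, where t=t] softmax_le_1[OF fin te(1)] by auto
    have B': "\<bar>D t e w\<bar> \<le> l * 1 * (1 + 1)" for w
    proof -
      have "\<bar>\<Sum>s\<in>T. ?p s w * v s e\<bar> \<le> 1"
        using v_le te by (intro sum_abs_softmax_le[OF fin]) auto
      then have "\<bar>v t e - (\<Sum>s\<in>T. ?p s w * v s e)\<bar> \<le> 1 + 1"
        using v_le[OF te] by linarith
      then show ?thesis
        unfolding D_def abs_mult using l B by (intro mult_mono) auto
    qed
    have mD: "D t e \<in> borel_measurable (PiM I (\<lambda>_. borel))"
      unfolding D_def by measurable
    note S = PiM_std_gauss_stein[OF fin(1) te(2) measurable_softmax[OF fin(1,2)] mD der cont B B']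
    show "integrable ?N (\<lambda>w. w e * ?p t w)" "integrable ?N (D t e)"
      "(\<integral>w. w e * ?p t w \<partial>?N) = (\<integral>w. D t e w \<partial>?N)"
      by (rule S)+
  qed
  \<comment> \<open>Origin of the 8: the exponent has variance \<open>4 * l\<^sup>2\<close> times a
    squared distance, which is at most 4 for vectors in the unit ball, and the Gaussian exponential
    moment halves it.\<close>
  have "(\<Sum>t\<in>T. \<Sum>s\<in>T. exp ((\<Sum>e\<in>I. (2 * l * (v t e - v s e))\<^sup>2) / 2)) \<le> (\<Sum>t\<in>T. \<Sum>s\<in>T. exp (8 * l\<^sup>2))"
  proof (intro sum_mono)
    fix t s assume ts: "t \<in> T" "s \<in> T"
    have "?d t s \<le> (\<Sum>e\<in>I. 2 * (v t e)\<^sup>2 + 2 * (v s e)\<^sup>2)"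
    proof (intro sum_mono)
      fix e show "(v t e - v s e)\<^sup>2 \<le> 2 * (v t e)\<^sup>2 + 2 * (v s e)\<^sup>2"
        using zero_le_power2[of "v t e + v s e"] by (simp add: power2_sum power2_diff)
    qed
    also have "\<dots> \<le> 4"
      using norm[OF ts(1)] norm[OF ts(2)] by (simp add: sum.distrib flip: sum_distrib_left)
    finally have "4 * l\<^sup>2 * ?d t s \<le> 4 * l\<^sup>2 * 4"
      by (intro mult_left_mono) auto
    moreover have "(\<Sum>e\<in>I. (2 * l * (v t e - v s e))\<^sup>2) = 4 * l\<^sup>2 * ?d t s"
      by (simp add: power_mult_distrib sum_distrib_left)
    ultimately show "exp ((\<Sum>e\<in>I. (2 * l * (v t e - v s e))\<^sup>2) / 2) \<le> exp (8 * l\<^sup>2)"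
      by simp
  qed
  also have "\<dots> = real (card T) ^ 2 * exp (8 * l\<^sup>2)"
    by (simp add: power2_eq_square)
  finally have expsum: "(\<Sum>t\<in>T. \<Sum>s\<in>T. exp ((\<Sum>e\<in>I. (2 * l * (v t e - v s e))\<^sup>2) / 2))
      \<le> real (card T) ^ 2 * exp (8 * l\<^sup>2)" .
  have K: "real (card T) > 0" using fin by (simp add: card_gt_0_iff)
  have int_sq: "integrable ?N (\<lambda>w. \<Sum>t\<in>T. (?p t w)\<^sup>2)"
  proof (intro Bochner_Integration.integrable_sum finite_measure.integrable_const_bound[of _ _ 1] prob_space.finite_measure PN AE_I2)
    fix t w assume "t \<in> T"
    then show "norm ((?p t w)\<^sup>2) \<le> 1"
      using softmax_nonneg[OF fin, of v l t w] softmax_le_1[OF fin, of t v l w] by (simp add: power_le_one)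
  qed simp
  have "(\<integral>w. (\<Sum>t\<in>T. (?p t w)\<^sup>2) \<partial>?N)
     \<le> (\<integral>w. (\<Sum>t\<in>T. \<Sum>s\<in>T. exp (\<Sum>e\<in>I. (2 * l * (v t e - v s e)) * w e)) / real (card T) ^ 3 \<partial>?N)"
    using PiM_std_gauss_mgf(1)[OF fin(1)]
    by (intro integral_mono[OF int_sq] softmax_sum_squares_le[OF fin] integrable_divide Bochner_Integration.integrable_sum)
  also have "\<dots> = (\<Sum>t\<in>T. \<Sum>s\<in>T. exp ((\<Sum>e\<in>I. (2 * l * (v t e - v s e))\<^sup>2) / 2)) / real (card T) ^ 3"
    using PiM_std_gauss_mgf[OF fin(1)] by (simp add: Bochner_Integration.integral_sum)
  also have "\<dots> \<le> (real (card T) ^ 2 * exp (8 * l\<^sup>2)) / real (card T) ^ 3"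
    using expsum by (intro divide_right_mono) auto
  also have "\<dots> = exp (8 * l\<^sup>2) / real (card T)"
    using K by (simp add: power2_eq_square power3_eq_cube)
  also have "\<dots> \<le> 1 / 4"
    using size K by (simp add: field_simps)
  finally have sq: "(\<integral>w. (\<Sum>t\<in>T. (?p t w)\<^sup>2) \<partial>?N) \<le> 1 / 4" .
  have "l * a / 4 \<le> (l * a / 2) * (1 - 2 * (\<integral>w. (\<Sum>t\<in>T. (?p t w)\<^sup>2) \<partial>?N))"
    using sq mult_left_mono[of "1/2" "1 - 2 * (\<integral>w. (\<Sum>t\<in>T. (?p t w)\<^sup>2) \<partial>?N)" "l * a / 2"] l a by auto
  also have "\<dots> = (\<integral>w. (l * a / 2) * (1 - 2 * (\<Sum>t\<in>T. (?p t w)\<^sup>2)) \<partial>?N)"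
    using int_sq prob_space.prob_space[OF PN] finite_measure.integrable_const[OF prob_space.finite_measure[OF PN], of "1::real"]
    by (simp add: Bochner_Integration.integral_diff del: Bochner_Integration.integral_sum)
  also have "\<dots> \<le> (\<integral>w. (\<Sum>t\<in>T. \<Sum>e\<in>I. v t e * D t e w) \<partial>?N)"
  proof (intro integral_mono)
    show "integrable ?N (\<lambda>w. \<Sum>t\<in>T. \<Sum>e\<in>I. v t e * D t e w)"
      using stein(2) by (intro Bochner_Integration.integrable_sum integrable_mult_right) auto
    show "integrable ?N (\<lambda>w. (l * a / 2) * (1 - 2 * (\<Sum>t\<in>T. (?p t w)\<^sup>2)))"
      using int_sq finite_measure.integrable_const[OF prob_space.finite_measure[OF PN]]
      by (intro integrable_mult_right Bochner_Integration.integrable_diff) auto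
    fix w
    have "(\<Sum>t\<in>T. \<Sum>e\<in>I. v t e * D t e w)
       = l * (\<Sum>t\<in>T. \<Sum>e\<in>I. v t e * (?p t w * (v t e - (\<Sum>s\<in>T. ?p s w * v s e))))"
      unfolding D_def by (simp add: sum_distrib_left mult_ac)
    also have "\<dots> = (l / 2) * (\<Sum>t\<in>T. \<Sum>s\<in>T. ?p t w * ?p s w * ?d t s)"
      unfolding softmax_gain_pointwise[OF fin] by simp
    also have "\<dots> \<ge> (l / 2) * (a * (1 - 2 * (\<Sum>t\<in>T. (?p t w)\<^sup>2)))"
      using l a near by (intro mult_left_mono softmax_pairs_lower_bound[OF fin])
        (auto simp: power2_commute sum_nonneg)
    finally show "(l * a / 2) * (1 - 2 * (\<Sum>t\<in>T. (?p t w)\<^sup>2)) \<le> (\<Sum>t\<in>T. \<Sum>e\<in>I. v t e * D t e w)"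
      by simp
  qed
  \<comment> \<open>Integration by parts read backwards: the expected derivative of a weight becomes
    its correlation with the coordinate \<open>w e\<close>.\<close>
  also have "\<dots> = (\<Sum>t\<in>T. \<Sum>e\<in>I. v t e * (\<integral>w. w e * ?p t w \<partial>?N))"
    using stein(2,3) by (simp add: Bochner_Integration.integral_sum)
  also have "\<dots> = (\<integral>w. (\<Sum>t\<in>T. ?p t w * lin I (v t) w) \<partial>?N)"
  proof -
    have "(\<lambda>w. \<Sum>t\<in>T. ?p t w * lin I (v t) w) = (\<lambda>w. \<Sum>t\<in>T. \<Sum>e\<in>I. v t e * (w e * ?p t w))"
      unfolding lin_def by (simp add: sum_distrib_left mult_ac)
    then show ?thesis using stein(1) by (simp add: Bochner_Integration.integral_sum)
  qed
  also have "\<dots> \<le> (\<integral>w. Max ((\<lambda>t. lin I (v t) w) ` T) \<partial>?N)"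
  proof (intro integral_mono int_max)
    have "(\<lambda>w. \<Sum>t\<in>T. ?p t w * lin I (v t) w) = (\<lambda>w. \<Sum>t\<in>T. \<Sum>e\<in>I. v t e * (w e * ?p t w))"
      unfolding lin_def by (simp add: sum_distrib_left mult_ac)
    then show "integrable ?N (\<lambda>w. \<Sum>t\<in>T. ?p t w * lin I (v t) w)"
      using stein(1) by (auto intro!: Bochner_Integration.integrable_sum)
    fix w
    have "(\<Sum>t\<in>T. ?p t w * lin I (v t) w) \<le> (\<Sum>t\<in>T. ?p t w * Max ((\<lambda>t. lin I (v t) w) ` T))"
      using fin softmax_nonneg[OF fin, of v l _ w] by (intro sum_mono mult_left_mono) auto
    also have "\<dots> = Max ((\<lambda>t. lin I (v t) w) ` T)"
      using softmax_sum[OF fin, of v l w] by (simp flip: sum_distrib_right)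
    finally show "(\<Sum>t\<in>T. ?p t w * lin I (v t) w) \<le> Max ((\<lambda>t. lin I (v t) w) ` T)" .
  qed
  finally show "(\<integral>w. Max ((\<lambda>t. lin I (v t) w) ` T) \<partial>?N) \<ge> l * a / 4" .
qed

section \<open>Lipschitz functions under Gaussian noise\<close>

definition noisy :: "real measure \<Rightarrow> real \<Rightarrow> real measure" where
  "noisy P s = distr (P \<Otimes>\<^sub>M std_gauss) borel (\<lambda>(x, w). x + s * w)"

lemma integrable_pair_fst:
  fixes h :: "'a \<Rightarrow> real"
  assumes "prob_space A" "prob_space B" "integrable A h"
  shows "integrable (A \<Otimes>\<^sub>M B) (\<lambda>z. h (fst z))"
    and "(\<integral>z. h (fst z) \<partial>(A \<Otimes>\<^sub>M B)) = integral\<^sup>L A h"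
proof -
  interpret A: prob_space A by fact
  interpret B: prob_space B by fact
  interpret pair_prob_space A B ..
  have [measurable]: "h \<in> borel_measurable A" using assms(3) by simp
  show *: "integrable (A \<Otimes>\<^sub>M B) (\<lambda>z. h (fst z))"
    using assms(3) by (intro Fubini_integrable) (auto simp: B.prob_space)
  show "(\<integral>z. h (fst z) \<partial>(A \<Otimes>\<^sub>M B)) = integral\<^sup>L A h"
    using integral_fst'[OF *] by (simp add: B.prob_space)
qed

lemma integrable_pair_snd:
  fixes h :: "'b \<Rightarrow> real"
  assumes "prob_space A" "prob_space B" "integrable B h"
  shows "integrable (A \<Otimes>\<^sub>M B) (\<lambda>z. h (snd z))"
proof -
  interpret A: prob_space A by fact
  interpret B: prob_space B by fact
  interpret pair_prob_space A B ..
  have [measurable]: "h \<in> borel_measurable B" using assms(3) by simp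
  show "integrable (A \<Otimes>\<^sub>M B) (\<lambda>z. h (snd z))"
    using assms(3) by (intro Fubini_integrable) auto
qed

lemma prob_space_noisy:
  assumes "prob_space P" "sets P = sets borel"
  shows "prob_space (noisy P s)"
proof -
  interpret A: prob_space P by fact
  interpret B: prob_space std_gauss by (rule prob_space_std_gauss)
  interpret pair_prob_space P std_gauss ..
  note [measurable_cong] = assms(2)
  show ?thesis unfolding noisy_def by (rule prob_space_distr) measurable
qed

lemma integrable_noisy_ident:
  assumes "prob_space P" "sets P = sets borel" "integrable P (\<lambda>x. x)"
  shows "integrable (noisy P s) (\<lambda>x. x)"
proof -
  note [measurable_cong] = assms(2)
  have "integrable (P \<Otimes>\<^sub>M std_gauss) (\<lambda>z. fst z + s * snd z)"
    using integrable_pair_fst(1)[OF assms(1) prob_space_std_gauss assms(3)]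
      integrable_pair_snd[OF assms(1) prob_space_std_gauss integrable_std_gauss_ident]
    by auto
  then show ?thesis
    unfolding noisy_def by (subst integrable_distr_eq) (auto simp: case_prod_unfold)
qed

lemma lipschitz_borel_measurable:
  fixes g :: "real \<Rightarrow> real"
  assumes "\<And>x y. \<bar>g x - g y\<bar> \<le> \<bar>x - y\<bar>"
  shows "g \<in> borel_measurable borel"
proof (rule borel_measurable_continuous_onI)
  have "1-lipschitz_on UNIV g"
    using assms by (intro lipschitz_onI) (auto simp: dist_real_def)
  then show "continuous_on UNIV g" by (rule lipschitz_on_continuous_on)
qed

lemma lipschitz_integrable:
  fixes g :: "real \<Rightarrow> real"
  assumes "\<And>x y. \<bar>g x - g y\<bar> \<le> \<bar>x - y\<bar>"
    and "prob_space P" "sets P = sets borel" "integrable P (\<lambda>x. x)"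
  shows "integrable P g"
proof (rule Bochner_Integration.integrable_bound)
  show "integrable P (\<lambda>x. \<bar>g 0\<bar> + \<bar>x\<bar>)"
    using assms(4) finite_measure.integrable_const[OF prob_space.finite_measure[OF assms(2)]]
    by (intro Bochner_Integration.integrable_add integrable_abs) auto
  note [measurable_cong] = assms(3) and [measurable] = lipschitz_borel_measurable[OF assms(1)]
  show "g \<in> borel_measurable P" by measurable
  show "AE x in P. norm (g x) \<le> norm (\<bar>g 0\<bar> + \<bar>x\<bar>)"
  proof (intro AE_I2)
    fix x show "norm (g x) \<le> norm (\<bar>g 0\<bar> + \<bar>x\<bar>)" using assms(1)[of x 0] by auto
  qed
qed

text \<open>The density is split into the minimum with its shift, over which the increment
  integrates to zero, and the excess of \<open>f x\<close> over the shifted value. On the excess the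
  increment is at most \<open>s * \<bar>w\<bar>\<close>, and the excess is \<open>f x\<close> times
  the positive part in the rejection assumption. The Lipschitz bound thus gives one factor
  \<open>s\<close>, and the assumption with exponent 1 will give the other.\<close>

lemma noisy_integral_lipschitz_le:
  fixes f g :: "real \<Rightarrow> real"
  assumes P: "prob_space P" "P = density lborel (\<lambda>x. ennreal (f x))" "integrable P (\<lambda>x. x)"
    and f[measurable]: "f \<in> borel_measurable borel" and nn: "\<And>x. f x \<ge> 0"
    and s: "s \<ge> 0" and g: "\<And>x y. \<bar>g x - g y\<bar> \<le> \<bar>x - y\<bar>"
  shows "integral\<^sup>L (noisy P s) g \<le> integral\<^sup>L P g +
    s * (\<integral>(x, w). \<bar>w\<bar> powr 1 * max 0 (1 - f (x + s * w) / f x) \<partial>(P \<Otimes>\<^sub>M std_gauss))"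
proof -
  note [measurable] = lipschitz_borel_measurable[OF g]
  have sP: "sets P = sets borel" using P(2) by simp
  note [measurable_cong] = sP
  let ?L = "lborel \<Otimes>\<^sub>M lborel :: (real \<times> real) measure"
  let ?R = "P \<Otimes>\<^sub>M std_gauss"
  define K where "K x w = g (x + s * w) - g x" for x w
  have mK[measurable]: "(\<lambda>z. K (fst z) (snd z)) \<in> borel_measurable (borel \<Otimes>\<^sub>M borel)"
    unfolding K_def by measurable
  have K: "\<bar>K x w\<bar> \<le> s * \<bar>w\<bar>" for x w
    using g[of "x + s * w" x] s by (simp add: K_def abs_mult)
  have R: "?R = density ?L (\<lambda>z. ennreal (f (fst z) * std_normal_density (snd z)))"
  proof -
    have "?R = density ?L (\<lambda>(x, w). ennreal (f x) * ennreal (std_normal_density w))"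
      unfolding P(2)
      by (rule pair_measure_density) (auto intro: prob_space_imp_sigma_finite prob_space_std_gauss lborel.sigma_finite_measure_axioms)
    then show ?thesis using nn by (simp add: case_prod_unfold ennreal_mult)
  qed
  have integral_R: "(\<integral>z. h z \<partial>?R) = (\<integral>z. f (fst z) * std_normal_density (snd z) * h z \<partial>?L)"
    and integrable_R: "integrable ?R h \<longleftrightarrow> integrable ?L (\<lambda>z. f (fst z) * std_normal_density (snd z) * h z)"
    if [measurable]: "h \<in> borel_measurable (borel \<Otimes>\<^sub>M borel)" for h :: "real \<times> real \<Rightarrow> real"
    unfolding R using nn by (simp_all add: integral_density integrable_density)
  have int_abs: "integrable ?L (\<lambda>z. f (fst z) * std_normal_density (snd z) * \<bar>snd z\<bar>)"
    using integrable_pair_snd[OF P(1) prob_space_std_gauss integrable_std_gauss_abs]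
    by (subst (asm) integrable_R) auto
  \<comment> \<open>A single domination by \<open>s * \<bar>w\<bar>\<close> times the joint density,
    finite by the first absolute Gaussian moment, serves every integrand below.\<close>
  have dom: "integrable ?L (\<lambda>z. std_normal_density (snd z) * k z * m z)"
    if [measurable]: "k \<in> borel_measurable (borel \<Otimes>\<^sub>M borel)" "m \<in> borel_measurable (borel \<Otimes>\<^sub>M borel)"
      and k: "\<And>z. \<bar>k z\<bar> \<le> s * \<bar>snd z\<bar>" and m: "\<And>z. 0 \<le> m z" "\<And>z. m z \<le> f (fst z)"
    for k m :: "real \<times> real \<Rightarrow> real"
  proof (rule Bochner_Integration.integrable_bound)
    show "integrable ?L (\<lambda>z. s * (f (fst z) * std_normal_density (snd z) * \<bar>snd z\<bar>))"
      using int_abs by (rule integrable_mult_right)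
    show "AE z in ?L. norm (std_normal_density (snd z) * k z * m z)
      \<le> norm (s * (f (fst z) * std_normal_density (snd z) * \<bar>snd z\<bar>))"
    proof (intro AE_I2)
      fix z :: "real \<times> real"
      have "\<bar>k z\<bar> * m z \<le> (s * \<bar>snd z\<bar>) * f (fst z)"
        using k m s by (intro mult_mono) auto
      then have "std_normal_density (snd z) * (\<bar>k z\<bar> * m z) \<le> std_normal_density (snd z) * ((s * \<bar>snd z\<bar>) * f (fst z))"
        by (intro mult_left_mono) auto
      then show "norm (std_normal_density (snd z) * k z * m z) \<le> norm (s * (f (fst z) * std_normal_density (snd z) * \<bar>snd z\<bar>))"
        using s nn m(1)[of z] by (simp add: abs_mult mult_ac)
    qed
  qed measurable
  define H where "H x w = std_normal_density w * K x w * min (f x) (f (x + s * w))" for x w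
  define D where "D x w = max 0 (f x - f (x + s * w))" for x w
  have mD[measurable]: "(\<lambda>z. D (fst z) (snd z)) \<in> borel_measurable (borel \<Otimes>\<^sub>M borel)"
    unfolding D_def by measurable
  have int_H: "integrable ?L (\<lambda>z. H (fst z) (snd z))"
    unfolding H_def using nn K by (intro dom) (auto simp: min_def)
  have int_D: "integrable ?L (\<lambda>z. std_normal_density (snd z) * K (fst z) (snd z) * D (fst z) (snd z))"
    using nn K by (intro dom) (auto simp: D_def)
  have int_D': "integrable ?L (\<lambda>z. std_normal_density (snd z) * (s * \<bar>snd z\<bar>) * D (fst z) (snd z))"
    using nn K s by (intro dom) (auto simp: D_def)
  have zero: "(\<integral>z. H (fst z) (snd z) \<partial>?L) = 0"
  proof -
    \<comment> \<open>For fixed \<open>w\<close>, translating \<open>x\<close> by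
      \<open>s * w\<close> exchanges the two arguments of the minimum and reverses the increment. So
      the inner integral is odd in \<open>w\<close>.\<close>
    define J where "J w = (\<integral>x. H x w \<partial>lborel)" for w
    have "J (- w) = - J w" for w
    proof -
      have "J (- w) = (\<integral>x. H (s * w + 1 * x) (- w) \<partial>lborel)"
        unfolding J_def using lborel_integral_real_affine[of 1 "\<lambda>x. H x (- w)" "s * w"] by simp
      also have "(\<lambda>x. H (s * w + 1 * x) (- w)) = (\<lambda>x. - H x w)"
      proof
        fix x
        have "std_normal_density (- w) = std_normal_density w" by (simp add: normal_density_def)
        then show "H (s * w + 1 * x) (- w) = - H x w"
          by (simp add: H_def K_def min.commute add.commute algebra_simps)
      qed
      finally show ?thesis by (simp add: J_def)
    qed
    then have "integral\<^sup>L lborel J = - integral\<^sup>L lborel J"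
      using lborel_integral_real_affine[of "-1" J 0] by simp
    moreover have "(\<integral>z. H (fst z) (snd z) \<partial>?L) = integral\<^sup>L lborel J"
      using lborel_pair.integral_snd[of H] int_H by (simp add: J_def[abs_def] case_prod_unfold)
    ultimately show ?thesis by simp
  qed
  have int_K: "integrable ?R (\<lambda>z. K (fst z) (snd z))"
  proof -
    have "integrable ?L (\<lambda>z. std_normal_density (snd z) * K (fst z) (snd z) * f (fst z))"
      using K nn by (intro dom) auto
    then show ?thesis by (subst integrable_R) (auto simp: mult_ac)
  qed
  have "integral\<^sup>L (noisy P s) g = (\<integral>z. g (fst z) + K (fst z) (snd z) \<partial>?R)"
    unfolding noisy_def by (subst integral_distr) (auto simp: case_prod_unfold K_def)
  also have "\<dots> = integral\<^sup>L P g + (\<integral>z. K (fst z) (snd z) \<partial>?R)"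
    using integrable_pair_fst[OF P(1) prob_space_std_gauss lipschitz_integrable[OF g P(1) sP P(3)]] int_K
    by simp
  also have "(\<integral>z. K (fst z) (snd z) \<partial>?R)
     = (\<integral>z. H (fst z) (snd z) + std_normal_density (snd z) * K (fst z) (snd z) * D (fst z) (snd z) \<partial>?L)"
  proof -
    have split: "f x * std_normal_density w * K x w = H x w + std_normal_density w * K x w * D x w" for x w
    proof -
      have "f x = min (f x) (f (x + s * w)) + D x w" by (auto simp: D_def)
      then have "f x * std_normal_density w * K x w
        = (min (f x) (f (x + s * w)) + D x w) * std_normal_density w * K x w" by simp
      then show ?thesis by (simp only: H_def distrib_left distrib_right mult_ac)
    qed
    show ?thesis by (subst integral_R[OF mK]) (simp only: split)
  qed
  also have "\<dots> = (\<integral>z. std_normal_density (snd z) * K (fst z) (snd z) * D (fst z) (snd z) \<partial>?L)"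
    using int_H int_D zero by simp
  also have "\<dots> \<le> (\<integral>z. std_normal_density (snd z) * (s * \<bar>snd z\<bar>) * D (fst z) (snd z) \<partial>?L)"
  proof (intro integral_mono int_D int_D' mult_right_mono mult_left_mono)
    fix z show "K (fst z) (snd z) \<le> s * \<bar>snd z\<bar>" using K[of "fst z" "snd z"] by simp
  qed (auto simp: D_def)
  also have "\<dots> = s * (\<integral>z. f (fst z) * std_normal_density (snd z) *
      (\<bar>snd z\<bar> powr 1 * max 0 (1 - f (fst z + s * snd z) / f (fst z))) \<partial>?L)"
  proof -
    \<comment> \<open>Where \<open>f x = 0\<close>, both sides vanish because \<open>f\<close> is
      nonnegative, so the value of a division by zero is harmless.\<close>
    have "D x w = f x * max 0 (1 - f (x + s * w) / f x)" for x w
      using nn[of x] nn[of "x + s * w"] by (cases "f x = 0") (auto simp: D_def max_def field_simps)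
    then have "std_normal_density w * (s * \<bar>w\<bar>) * D x w = s * (f x * std_normal_density w *
      (\<bar>w\<bar> powr 1 * max 0 (1 - f (x + s * w) / f x)))" for x w
      by (simp only: powr_one abs_ge_zero mult_ac)
    then show ?thesis by (simp only: integral_mult_right_zero)
  qed
  also have "(\<integral>z. f (fst z) * std_normal_density (snd z) *
      (\<bar>snd z\<bar> powr 1 * max 0 (1 - f (fst z + s * snd z) / f (fst z))) \<partial>?L)
      = (\<integral>(x, w). \<bar>w\<bar> powr 1 * max 0 (1 - f (x + s * w) / f x) \<partial>?R)"
    by (subst integral_R) (auto simp: case_prod_unfold)
  finally show ?thesis by simp
qed

section \<open>From one noisy coordinate to a product of them\<close>

lemma PiM_lipschitz_integrable:
  fixes g :: "('i \<Rightarrow> real) \<Rightarrow> real"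
  assumes "finite I" and Q: "prob_space Q" "sets Q = sets borel" "integrable Q (\<lambda>x. x)"
    and [measurable]: "g \<in> borel_measurable (PiM I (\<lambda>_. borel))"
    and g: "\<And>x y. \<bar>g x - g y\<bar> \<le> (\<Sum>e\<in>I. \<bar>x e - y e\<bar>)"
  shows "integrable (PiM I (\<lambda>_. Q)) g"
proof (rule Bochner_Integration.integrable_bound)
  have [measurable_cong]: "sets (PiM I (\<lambda>_. Q)) = sets (PiM I (\<lambda>_. borel))"
    using Q by (intro sets_PiM_cong) auto
  show "g \<in> borel_measurable (PiM I (\<lambda>_. Q))" by measurable
  have "finite_measure (PiM I (\<lambda>_. Q))"
    using Q by (intro prob_space.finite_measure prob_space_PiM) auto
  then show "integrable (PiM I (\<lambda>_. Q)) (\<lambda>x. \<bar>g (\<lambda>_. 0)\<bar> + (\<Sum>e\<in>I. \<bar>x e\<bar>))"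
    using integrable_PiM_component[OF Q(1) Q(3)]
    by (intro Bochner_Integration.integrable_add Bochner_Integration.integrable_sum integrable_abs finite_measure.integrable_const)
  show "AE x in PiM I (\<lambda>_. Q). norm (g x) \<le> norm (\<bar>g (\<lambda>_. 0)\<bar> + (\<Sum>e\<in>I. \<bar>x e\<bar>))"
  proof (intro AE_I2)
    fix x show "norm (g x) \<le> norm (\<bar>g (\<lambda>_. 0)\<bar> + (\<Sum>e\<in>I. \<bar>x e\<bar>))"
      using g[of x "\<lambda>_. 0"] by auto
  qed
qed

text \<open>One coordinate is exchanged at a time, at cost \<open>c\<close>. Integrating a
  coordinate out preserves the Lipschitz bound in the others, so the induction hypothesis applies to
  the partial integral.\<close>

lemma PiM_integral_lipschitz_le:
  fixes P Q :: "real measure" and g :: "('i \<Rightarrow> real) \<Rightarrow> real"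
  assumes "finite I"
    and P: "prob_space P" "sets P = sets borel" "integrable P (\<lambda>x. x)"
    and Q: "prob_space Q" "sets Q = sets borel" "integrable Q (\<lambda>x. x)"
    and one: "\<And>g. (\<And>x y. \<bar>g x - g y\<bar> \<le> \<bar>x - y\<bar>) \<Longrightarrow> integral\<^sup>L Q g \<le> integral\<^sup>L P g + c"
    and "g \<in> borel_measurable (PiM I (\<lambda>_. borel))"
    and "\<And>x y. \<bar>g x - g y\<bar> \<le> (\<Sum>e\<in>I. \<bar>x e - y e\<bar>)"
  shows "integral\<^sup>L (PiM I (\<lambda>_. Q)) g \<le> integral\<^sup>L (PiM I (\<lambda>_. P)) g + real (card I) * c"
  using assms(1,9,10)
proof (induction I arbitrary: g rule: finite_induct)
  case empty
  then show ?case by (simp add: PiM_empty)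
next
  case (insert e I)
  note [measurable] = insert.prems(1)
  interpret P: product_prob_space "\<lambda>_::'i. P" by (rule product_prob_space_const[OF P(1)])
  interpret Q: product_prob_space "\<lambda>_::'i. Q" by (rule product_prob_space_const[OF Q(1)])
  have upd: "\<bar>g (y(e := x)) - g (y'(e := x'))\<bar> \<le> \<bar>x - x'\<bar> + (\<Sum>e\<in>I. \<bar>y e - y' e\<bar>)" for x x' y y'
  proof -
    have "(\<Sum>k\<in>I. \<bar>(y(e := x)) k - (y'(e := x')) k\<bar>) = (\<Sum>k\<in>I. \<bar>y k - y' k\<bar>)"
      using insert.hyps by (intro sum.cong) auto
    then show ?thesis using insert.prems(2)[of "y(e := x)" "y'(e := x')"] insert.hyps
      by (simp add: fun_upd_def)
  qed
  have lip1: "\<bar>g (y(e := x)) - g (y(e := x'))\<bar> \<le> \<bar>x - x'\<bar>" for x x' y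
    using upd[of y x y x'] by simp
  define G where "G R y = (\<integral>x. g (y(e := x)) \<partial>R)" for R :: "real measure" and y
  have G: "G R \<in> borel_measurable (PiM I (\<lambda>_. borel))" "\<bar>G R y - G R y'\<bar> \<le> (\<Sum>e\<in>I. \<bar>y e - y' e\<bar>)"
    if R: "prob_space R" "sets R = sets borel" "integrable R (\<lambda>x. x)" for R y y'
  proof -
    interpret R: prob_space R by fact
    note [measurable_cong] = R(2)
    show "G R \<in> borel_measurable (PiM I (\<lambda>_. borel))"
      unfolding G_def by (rule R.borel_measurable_lebesgue_integral) measurable
    have i: "integrable R (\<lambda>x. g (y(e := x)))" for y
      by (rule lipschitz_integrable[OF lip1 R])
    have "\<bar>G R y - G R y'\<bar> = \<bar>\<integral>x. g (y(e := x)) - g (y'(e := x)) \<partial>R\<bar>"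
      unfolding G_def using i by simp
    also have "\<dots> \<le> (\<integral>x. \<bar>g (y(e := x)) - g (y'(e := x))\<bar> \<partial>R)"
      by (rule integral_abs_bound)
    also have "\<dots> \<le> (\<integral>x. (\<Sum>e\<in>I. \<bar>y e - y' e\<bar>) \<partial>R)"
    proof (intro integral_mono R.integrable_const integrable_abs Bochner_Integration.integrable_diff i)
      fix x show "\<bar>g (y(e := x)) - g (y'(e := x))\<bar> \<le> (\<Sum>e\<in>I. \<bar>y e - y' e\<bar>)"
        using upd[of y x y' x] by simp
    qed
    also have "\<dots> = (\<Sum>e\<in>I. \<bar>y e - y' e\<bar>)" by (simp add: R.prob_space)
    finally show "\<bar>G R y - G R y'\<bar> \<le> (\<Sum>e\<in>I. \<bar>y e - y' e\<bar>)" .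
  qed
  have iQ: "integrable (PiM I (\<lambda>_. Q)) (G R)" if "prob_space R" "sets R = sets borel" "integrable R (\<lambda>x. x)" for R
    by (rule PiM_lipschitz_integrable[OF insert.hyps(1) Q G[OF that]])
  have fin: "finite_measure (PiM I (\<lambda>_. Q))"
    using Q by (intro prob_space.finite_measure prob_space_PiM) auto
  have prob: "measure (PiM I (\<lambda>_. Q)) (space (PiM I (\<lambda>_. Q))) = 1"
    using Q by (intro prob_space.prob_space prob_space_PiM) auto
  have finI: "finite (insert e I)" using insert by simp
  have "integral\<^sup>L (PiM (insert e I) (\<lambda>_. Q)) g = integral\<^sup>L (PiM I (\<lambda>_. Q)) (G Q)"
    unfolding G_def
    by (rule Q.product_integral_insert[OF insert.hyps(1,2) PiM_lipschitz_integrable[OF finI Q insert.prems]])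
  also have "\<dots> \<le> (\<integral>y. G P y + c \<partial>PiM I (\<lambda>_. Q))"
    using one[OF lip1] by (intro integral_mono Bochner_Integration.integrable_add iQ Q P finite_measure.integrable_const[OF fin])
      (auto simp: G_def)
  also have "\<dots> = integral\<^sup>L (PiM I (\<lambda>_. Q)) (G P) + c"
    using iQ[OF P] finite_measure.integrable_const[OF fin, of c] prob by simp
  also have "\<dots> \<le> integral\<^sup>L (PiM I (\<lambda>_. P)) (G P) + real (card I) * c + c"
    using insert.IH[OF G[OF P]] by simp
  also have "integral\<^sup>L (PiM I (\<lambda>_. P)) (G P) = integral\<^sup>L (PiM (insert e I) (\<lambda>_. P)) g"
    unfolding G_def
    by (rule P.product_integral_insert[OF insert.hyps(1,2) PiM_lipschitz_integrable[OF finI P insert.prems], symmetric])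
  finally show ?case using insert.hyps by (simp add: algebra_simps)
qed

text \<open>It suffices to compare the two measures on boxes, where the integrand factorises over
  the coordinates.\<close>

lemma PiM_noisy:
  fixes I :: "'i set"
  assumes "finite I" and P: "prob_space P" "sets P = sets borel"
  shows "distr (PiM I (\<lambda>_. P) \<Otimes>\<^sub>M PiM I (\<lambda>_. std_gauss)) (PiM I (\<lambda>_. borel))
      (\<lambda>(x, w). \<lambda>e\<in>I. x e + s * w e) = PiM I (\<lambda>_. noisy P s)" (is "distr ?PP _ ?h = _")
proof -
  interpret P: product_prob_space "\<lambda>_::'i. P" by (rule product_prob_space_const[OF P(1)])
  interpret G: product_prob_space "\<lambda>_::'i. std_gauss" by (rule product_prob_space_const[OF prob_space_std_gauss])
  interpret N: product_prob_space "\<lambda>_::'i. noisy P s" by (rule product_prob_space_const[OF prob_space_noisy[OF P]])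
  have G1: "sigma_finite_measure std_gauss"
    by (intro prob_space_imp_sigma_finite prob_space_std_gauss)
  have GI: "sigma_finite_measure (PiM I (\<lambda>_. std_gauss))"
    by (intro prob_space_imp_sigma_finite prob_space_PiM prob_space_std_gauss)
  have sN: "sets (noisy P s) = sets borel" by (simp add: noisy_def)
  note [measurable_cong] = P(2)
  have [measurable_cong]: "sets (PiM I (\<lambda>_. P)) = sets (PiM I (\<lambda>_. borel))"
    using P by (intro sets_PiM_cong) auto
  have [measurable_cong]: "sets (PiM I (\<lambda>_. std_gauss)) = sets (PiM I (\<lambda>_. borel))"
    by (intro sets_PiM_cong) auto
  have mh[measurable]: "?h \<in> measurable ?PP (PiM I (\<lambda>_. borel))"
    unfolding case_prod_unfold by measurable
  show ?thesis
  proof (rule N.PiM_eqI[OF assms(1)])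
    show "sets (distr ?PP (PiM I (\<lambda>_. borel)) ?h) = sets (PiM I (\<lambda>_. noisy P s))"
      using sN by (auto intro!: sets_PiM_cong)
  next
    fix A assume "\<And>i. i \<in> I \<Longrightarrow> A i \<in> sets (noisy P s)"
    then have A[measurable]: "\<And>i. i \<in> I \<Longrightarrow> A i \<in> sets borel" by (simp add: sN)
    have box: "Pi\<^sub>E I A \<in> sets (PiM I (\<lambda>_. borel))"
      using assms(1) A by (intro sets_PiM_I_finite) auto
    \<comment> \<open>The shifted vector is restricted to \<open>I\<close>, hence extensional, so
      lying in the box is a condition on each coordinate separately.\<close>
    have ind: "indicator (Pi\<^sub>E I A) (?h z) = (\<Prod>e\<in>I. indicator (A e) (fst z e + s * snd z e) :: ennreal)" for z
      using assms(1) by (auto simp: case_prod_unfold PiE_iff indicator_def prod_zero_iff)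
    have "emeasure (distr ?PP (PiM I (\<lambda>_. borel)) ?h) (Pi\<^sub>E I A)
      = (\<integral>\<^sup>+z. indicator (Pi\<^sub>E I A) z \<partial>distr ?PP (PiM I (\<lambda>_. borel)) ?h)"
      using box by simp
    also have "\<dots> = (\<integral>\<^sup>+z. indicator (Pi\<^sub>E I A) (?h z) \<partial>?PP)"
      using box by (intro nn_integral_distr mh) auto
    also have "\<dots> = (\<integral>\<^sup>+z. (\<Prod>e\<in>I. indicator (A e) (fst z e + s * snd z e)) \<partial>?PP)"
      unfolding ind ..
    also have "\<dots> = (\<integral>\<^sup>+x. \<integral>\<^sup>+w. (\<Prod>e\<in>I. indicator (A e) (x e + s * w e)) \<partial>PiM I (\<lambda>_. std_gauss) \<partial>PiM I (\<lambda>_. P))"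
      by (subst sigma_finite_measure.nn_integral_fst[OF GI, symmetric]) auto
    also have "\<dots> = (\<integral>\<^sup>+x. (\<Prod>e\<in>I. \<integral>\<^sup>+u. indicator (A e) (x e + s * u) \<partial>std_gauss) \<partial>PiM I (\<lambda>_. P))"
      by (intro nn_integral_cong G.product_nn_integral_prod assms(1)) auto
    also have "\<dots> = (\<Prod>e\<in>I. \<integral>\<^sup>+y. \<integral>\<^sup>+u. indicator (A e) (y + s * u) \<partial>std_gauss \<partial>P)"
      by (intro P.product_nn_integral_prod assms(1)) auto
    also have "\<dots> = (\<Prod>e\<in>I. emeasure (noisy P s) (A e))"
    proof (intro prod.cong refl)
      fix e assume [simp]: "e \<in> I"
      have "emeasure (noisy P s) (A e) = (\<integral>\<^sup>+y. indicator (A e) y \<partial>noisy P s)"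
        using A sN by simp
      also have "\<dots> = (\<integral>\<^sup>+z. indicator (A e) (fst z + s * snd z) \<partial>(P \<Otimes>\<^sub>M std_gauss))"
        unfolding noisy_def by (subst nn_integral_distr) (auto simp: case_prod_unfold)
      also have "\<dots> = (\<integral>\<^sup>+y. \<integral>\<^sup>+u. indicator (A e) (y + s * u) \<partial>std_gauss \<partial>P)"
        by (subst sigma_finite_measure.nn_integral_fst[OF G1, symmetric]) auto
      finally show "(\<integral>\<^sup>+y. \<integral>\<^sup>+u. indicator (A e) (y + s * u) \<partial>std_gauss \<partial>P) = emeasure (noisy P s) (A e)" ..
    qed
    finally show "emeasure (distr ?PP (PiM I (\<lambda>_. borel)) ?h) (Pi\<^sub>E I A) = (\<Prod>e\<in>I. emeasure (noisy P s) (A e))" .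
  qed
qed

section \<open>Near-maximizers of random linear forms\<close>

lemma lin_diff_le:
  assumes "\<And>e. e \<in> I \<Longrightarrow> \<bar>v e\<bar> \<le> 1"
  shows "lin I v x \<le> lin I v y + (\<Sum>e\<in>I. \<bar>x e - y e\<bar>)"
proof -
  have "lin I v x - lin I v y = (\<Sum>e\<in>I. v e * (x e - y e))"
    by (simp add: lin_def right_diff_distrib sum_subtractf)
  also have "\<dots> \<le> (\<Sum>e\<in>I. \<bar>x e - y e\<bar>)"
  proof (intro sum_mono)
    fix e assume "e \<in> I"
    then have "\<bar>v e\<bar> * \<bar>x e - y e\<bar> \<le> 1 * \<bar>x e - y e\<bar>"
      using assms by (intro mult_right_mono) auto
    then show "v e * (x e - y e) \<le> \<bar>x e - y e\<bar>"
      by (metis abs_ge_self abs_mult mult_1 order_trans)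
  qed
  finally show ?thesis by simp
qed

text \<open>Two estimates of the same quantity, the expected rise of the maximum under noise: from
  below through the event \<open>B\<close>, from above by the cost of noise summed over the
  coordinates. \<open>F\<close> lists the candidate sets; being finite, it makes \<open>B\<close>
  measurable.\<close>

lemma prob_near_maximizers_le:
  fixes I :: "'i set" and S :: "'t set" and v :: "'t \<Rightarrow> 'i \<Rightarrow> real" and f :: "real \<Rightarrow> real" and r :: real
  assumes P: "prob_space P" "P = density lborel (\<lambda>x. ennreal (f x))" "integrable P (\<lambda>x. x)"
    and f: "f \<in> borel_measurable borel" "\<And>x. f x \<ge> 0"
    and rej: "(\<integral>(x, w). \<bar>w\<bar> powr 1 * max 0 (1 - f (x + s * w) / f x) \<partial>(P \<Otimes>\<^sub>M std_gauss)) \<le> C * s"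
    and s: "s \<ge> 0" and l: "l \<ge> 0" and a: "a \<ge> 0"
    and fin: "finite I" "finite S" "S \<noteq> {}" "finite F"
    and v: "\<And>t e. t \<in> S \<Longrightarrow> e \<in> I \<Longrightarrow> \<bar>v t e\<bar> \<le> 1"
    and F: "\<And>T. T \<in> F \<Longrightarrow> T \<subseteq> S" "\<And>T. T \<in> F \<Longrightarrow> T \<noteq> {}"
    and norm: "\<And>t. t \<in> S \<Longrightarrow> (\<Sum>e\<in>I. (s * v t e)\<^sup>2) \<le> 1"
    and near: "\<And>T t. T \<in> F \<Longrightarrow> t \<in> T \<Longrightarrow>
       card {u \<in> T. (\<Sum>e\<in>I. (s * v t e - s * v u e)\<^sup>2) < a} \<le> 2"
    and size: "\<And>T. T \<in> F \<Longrightarrow> real (card T) \<ge> 4 * exp (8 * l\<^sup>2)"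
  defines "B \<equiv> {x \<in> space (PiM I (\<lambda>_. borel)). \<exists>T\<in>F. \<forall>t\<in>T.
      Max ((\<lambda>u. lin I (v u) x) ` S) - r \<le> lin I (v t) x}"
  shows "B \<in> sets (PiM I (\<lambda>_. borel))"
    and "measure (PiM I (\<lambda>_. P)) B * (l * a / 4 - r) \<le> real (card I) * (C * s\<^sup>2)"
proof -
  have sP: "sets P = sets borel" using P(2) by simp
  let ?P = "PiM I (\<lambda>_. P)" and ?N = "PiM I (\<lambda>_. std_gauss)"
  interpret PI: prob_space ?P using P(1) by (intro prob_space_PiM)
  interpret NI: prob_space ?N by (intro prob_space_PiM prob_space_std_gauss)
  interpret PN: pair_prob_space ?P ?N ..
  note [measurable_cong] = sP
  have [measurable_cong]: "sets ?P = sets (PiM I (\<lambda>_. borel))"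
    using sP by (intro sets_PiM_cong) auto
  have [measurable_cong]: "sets ?N = sets (PiM I (\<lambda>_. borel))"
    by (intro sets_PiM_cong) auto
  note [measurable] = measurable_lin[OF fin(1)]
  define g where "g x = Max ((\<lambda>u. lin I (v u) x) ` S)" for x
  have mg[measurable]: "g \<in> borel_measurable (PiM I (\<lambda>_. borel))"
    unfolding g_def by (intro borel_measurable_Max fin measurable_lin)
  have g_ge: "lin I (v u) x \<le> g x" if "u \<in> S" for u x
    unfolding g_def using fin that by auto
  have g_le: "g x \<le> y" if "\<And>u. u \<in> S \<Longrightarrow> lin I (v u) x \<le> y" for x y
    unfolding g_def using fin that by (subst Max_le_iff) auto
  have g_lip: "\<bar>g x - g y\<bar> \<le> (\<Sum>e\<in>I. \<bar>x e - y e\<bar>)" for x y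
  proof -
    have "g x \<le> g y + (\<Sum>e\<in>I. \<bar>x e - y e\<bar>)" for x y
    proof (rule g_le)
      fix u assume u: "u \<in> S"
      show "lin I (v u) x \<le> g y + (\<Sum>e\<in>I. \<bar>x e - y e\<bar>)"
        using lin_diff_le[of I "v u" x y] v[OF u] g_ge[OF u, of y] by auto
    qed
    from this[of x y] this[of y x] show ?thesis by (simp add: abs_minus_commute)
  qed
  have B_eq: "B = {x \<in> space (PiM I (\<lambda>_. borel)). \<exists>T\<in>F. \<forall>t\<in>T. g x - r \<le> lin I (v t) x}"
    by (simp add: B_def g_def)
  have finT: "finite T" if "T \<in> F" for T using F(1)[OF that] fin(2) by (rule finite_subset)
  show mB[measurable]: "B \<in> sets (PiM I (\<lambda>_. borel))"
    unfolding B_eq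
    by (intro sets.sets_Collect_finite_Ex sets.sets_Collect_finite_All fin(4) finT) measurable
  define h where "h x w = g (\<lambda>e\<in>I. x e + s * w e)" for x w
  have lin_shift: "lin I u (\<lambda>e\<in>I. x e + s * w e) = lin I u x + lin I (\<lambda>e. s * u e) w" for u x w
    unfolding lin_def sum.distrib[symmetric] by (intro sum.cong) (auto simp: algebra_simps)
  have mh[measurable]: "(\<lambda>(x, w). h x w) \<in> borel_measurable (PiM I (\<lambda>_. borel) \<Otimes>\<^sub>M PiM I (\<lambda>_. borel))"
    unfolding h_def case_prod_unfold by measurable
  have int_w: "integrable ?N (\<lambda>w. w e)" if "e \<in> I" for e
    using integrable_PiM_component[OF prob_space_std_gauss integrable_std_gauss_ident that] .
  have int_lin: "integrable ?N (lin I u)" for u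
    unfolding lin_def using int_w by (intro Bochner_Integration.integrable_sum) auto
  have w_0: "(\<integral>w. w e \<partial>?N) = 0" if "e \<in> I" for e
    using integral_PiM_component[OF prob_space_std_gauss _ that, of "\<lambda>x. x"] integral_std_gauss_ident by simp
  have lin_0: "(\<integral>w. lin I u w \<partial>?N) = 0" for u
  proof -
    have "(\<integral>w. lin I u w \<partial>?N) = (\<Sum>e\<in>I. u e * (\<integral>w. w e \<partial>?N))"
      unfolding lin_def using int_w by (simp add: Bochner_Integration.integral_sum)
    also have "\<dots> = 0"
      using w_0 by (intro sum.neutral) auto
    finally show ?thesis .
  qed
  have int_h: "integrable ?N (h x)" for x
  proof (rule Bochner_Integration.integrable_bound)
    show "integrable ?N (\<lambda>w. \<bar>g x\<bar> + (\<Sum>e\<in>I. s * \<bar>w e\<bar>))"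
      using int_w by (intro Bochner_Integration.integrable_add Bochner_Integration.integrable_sum) auto
    show "h x \<in> borel_measurable ?N"
      unfolding h_def by measurable
    show "AE w in ?N. norm (h x w) \<le> norm (\<bar>g x\<bar> + (\<Sum>e\<in>I. s * \<bar>w e\<bar>))"
    proof (intro AE_I2)
      fix w
      have "(\<Sum>e\<in>I. \<bar>(\<lambda>e\<in>I. x e + s * w e) e - x e\<bar>) = (\<Sum>e\<in>I. s * \<bar>w e\<bar>)"
        using s by (intro sum.cong) (auto simp: abs_mult)
      then show "norm (h x w) \<le> norm (\<bar>g x\<bar> + (\<Sum>e\<in>I. s * \<bar>w e\<bar>))"
        using g_lip[of "\<lambda>e\<in>I. x e + s * w e" x] unfolding h_def by auto
    qed
  qed
  have gain: "g x + indicator B x * (l * a / 4 - r) \<le> (\<integral>w. h x w \<partial>?N)" if x: "x \<in> space ?P" for x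
  proof (cases "x \<in> B")
    case True
    then obtain T where T: "T \<in> F" "\<And>t. t \<in> T \<Longrightarrow> g x - r \<le> lin I (v t) x"
      unfolding B_eq by auto
    let ?M = "\<lambda>w. Max ((\<lambda>t. lin I ((\<lambda>t e. s * v t e) t) w) ` T)"
    have M: "integrable ?N ?M" "l * a / 4 \<le> (\<integral>w. ?M w \<partial>?N)"
      using expected_max_lower_bound[OF fin(1) finT[OF T(1)] F(2)[OF T(1)] l a, of "\<lambda>t e. s * v t e"]
        norm near[OF T(1)] F(1)[OF T(1)] size[OF T(1)] by auto
    \<comment> \<open>Only the competitors in \<open>T\<close> are kept: each starts within
      \<open>r\<close> of the maximum, and the noise raises the best of them by
      \<open>l * a / 4\<close> on average.\<close>
    have "g x + (l * a / 4 - r) \<le> (\<integral>w. (g x - r) + ?M w \<partial>?N)"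
      using M by (simp add: NI.prob_space)
    also have "\<dots> \<le> (\<integral>w. h x w \<partial>?N)"
    proof (intro integral_mono Bochner_Integration.integrable_add NI.integrable_const M(1) int_h)
      fix w
      have "?M w \<in> (\<lambda>t. lin I (\<lambda>e. s * v t e) w) ` T"
        using finT[OF T(1)] F(2)[OF T(1)] by (intro Max_in) auto
      then obtain t where t: "t \<in> T" "?M w = lin I (\<lambda>e. s * v t e) w" by auto
      have "g x - r + ?M w \<le> lin I (v t) (\<lambda>e\<in>I. x e + s * w e)"
        unfolding lin_shift t(2) using T(2)[OF t(1)] by simp
      also have "\<dots> \<le> h x w"
        unfolding h_def using t(1) F(1)[OF T(1)] by (intro g_ge) auto
      finally show "g x - r + ?M w \<le> h x w" .
    qed
    finally show ?thesis using True by simp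
  next
    case False
    \<comment> \<open>Off \<open>B\<close> a fixed maximizer suffices as competitor, since the noise
      adds a centred variable to its value.\<close>
    have "g x \<in> (\<lambda>u. lin I (v u) x) ` S"
      unfolding g_def using fin by (intro Max_in) auto
    then obtain u where u: "u \<in> S" "g x = lin I (v u) x" by auto
    have "g x = (\<integral>w. g x + lin I (\<lambda>e. s * v u e) w \<partial>?N)"
      using int_lin lin_0 by (simp add: NI.prob_space)
    also have "\<dots> \<le> (\<integral>w. h x w \<partial>?N)"
    proof (intro integral_mono Bochner_Integration.integrable_add NI.integrable_const int_lin int_h)
      fix w show "g x + lin I (\<lambda>e. s * v u e) w \<le> h x w"
        unfolding h_def u(2) lin_shift[symmetric] using u(1) by (rule g_ge)
    qed
    finally show ?thesis using False by simp
  qed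
  note Q = prob_space_noisy[OF P(1) sP, of s] integrable_noisy_ident[OF P(1) sP P(3), of s]
  have sQ: "sets (noisy P s) = sets borel" by (simp add: noisy_def)
  have one: "integral\<^sup>L (noisy P s) k \<le> integral\<^sup>L P k + C * s\<^sup>2"
    if "\<And>x y. \<bar>k x - k y\<bar> \<le> \<bar>x - y\<bar>" for k :: "real \<Rightarrow> real"
    using noisy_integral_lipschitz_le[OF P f s that] mult_left_mono[OF rej s]
    by (simp add: power2_eq_square mult_ac)
  have int_g: "integrable ?P g"
    by (rule PiM_lipschitz_integrable[OF fin(1) P(1) sP P(3) mg g_lip])
  have int_gQ: "integrable (PiM I (\<lambda>_. noisy P s)) g"
    by (rule PiM_lipschitz_integrable[OF fin(1) Q(1) sQ Q(2) mg g_lip])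
  have mshift: "(\<lambda>(x, w). \<lambda>e\<in>I. x e + s * w e) \<in> measurable (?P \<Otimes>\<^sub>M ?N) (PiM I (\<lambda>_. borel))"
    unfolding case_prod_unfold by measurable
  have hpair: "(\<lambda>z. g ((\<lambda>(x, w). \<lambda>e\<in>I. x e + s * w e) z)) = (\<lambda>(x, w). h x w)"
    by (auto simp: h_def)
  have int_pair: "integrable (?P \<Otimes>\<^sub>M ?N) (\<lambda>(x, w). h x w)"
    using int_gQ unfolding PiM_noisy[OF fin(1) P(1) sP, symmetric] integrable_distr_eq[OF mshift mg] hpair .
  have B_int: "integrable ?P (\<lambda>x. indicator B x * (l * a / 4 - r))"
    by (intro integrable_mult_left integrable_real_indicator) (auto simp: PI.emeasure_eq_measure)
  have "integral\<^sup>L ?P g + measure ?P B * (l * a / 4 - r)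
     = (\<integral>x. g x + indicator B x * (l * a / 4 - r) \<partial>?P)"
    using int_g B_int by simp
  also have "\<dots> \<le> (\<integral>x. (\<integral>w. h x w \<partial>?N) \<partial>?P)"
    using PN.integrable_fst'[OF int_pair] by (intro integral_mono Bochner_Integration.integrable_add int_g B_int gain) auto
  also have "\<dots> = (\<integral>z. (\<lambda>(x, w). h x w) z \<partial>(?P \<Otimes>\<^sub>M ?N))"
    using PN.integral_fst'[OF int_pair] by simp
  also have "\<dots> = integral\<^sup>L (PiM I (\<lambda>_. noisy P s)) g"
    unfolding PiM_noisy[OF fin(1) P(1) sP, symmetric] integral_distr[OF mshift mg] hpair ..
  also have "\<dots> \<le> integral\<^sup>L ?P g + real (card I) * (C * s\<^sup>2)"
    by (rule PiM_integral_lipschitz_le[OF fin(1) P(1) sP P(3) Q(1) sQ Q(2) one mg g_lip])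
  finally show "measure ?P B * (l * a / 4 - r) \<le> real (card I) * (C * s\<^sup>2)" by simp
qed

section \<open>Spin configurations\<close>

definition spin_products :: "(nat \<Rightarrow> real) \<Rightarrow> nat \<times> nat \<Rightarrow> real" where
  "spin_products \<sigma> = (\<lambda>(i, j). \<sigma> i * \<sigma> j)"

lemma sk_hamiltonian_eq: "sk_hamiltonian n x \<sigma> = - lin (edges n) (spin_products \<sigma>) x"
  unfolding sk_hamiltonian_def lin_def spin_products_def
  by (simp add: case_prod_unfold mult_ac)

lemma edges_subset: "edges n \<subseteq> {1..n} \<times> {1..n}"
  by (auto simp: edges_def)

lemma finite_edges: "finite (edges n)"
  by (rule finite_subset[OF edges_subset]) auto

lemma card_edges_le: "real (card (edges n)) \<le> (real n)\<^sup>2"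
proof -
  have "card (edges n) \<le> card ({1..n} \<times> {1..n})"
    by (intro card_mono edges_subset) auto
  then show ?thesis by (simp add: power2_eq_square flip: of_nat_mult)
qed

lemma edges_nonempty: "2 \<le> n \<Longrightarrow> edges n \<noteq> {}"
proof -
  assume "2 \<le> n"
  then have "(1, 2) \<in> edges n" by (simp add: edges_def)
  then show ?thesis by blast
qed

lemma finite_spins: "finite (spins n)"
  by (rule finite_subset[of _ "{1..n} \<rightarrow>\<^sub>E {1, -1}"]) (auto simp: spins_def intro!: finite_PiE)

lemma spins_nonempty: "1 \<le> n \<Longrightarrow> spins n \<noteq> {}"
  by (auto simp: spins_def intro!: exI[of _ "\<lambda>i\<in>{1..n}. 1"])

lemma spins_values: "\<sigma> \<in> spins n \<Longrightarrow> i \<in> {1..n} \<Longrightarrow> \<sigma> i = 1 \<or> \<sigma> i = -1"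
  by (auto simp: spins_def PiE_iff)

lemma spin_products_abs: "\<sigma> \<in> spins n \<Longrightarrow> e \<in> edges n \<Longrightarrow> \<bar>spin_products \<sigma> e\<bar> = 1"
proof -
  assume *: "\<sigma> \<in> spins n" "e \<in> edges n"
  then have "fst e \<in> {1..n}" "snd e \<in> {1..n}" using edges_subset[of n] by auto
  then show ?thesis
    using spins_values[OF *(1), of "fst e"] spins_values[OF *(1), of "snd e"]
    by (auto simp: spin_products_def case_prod_unfold abs_mult)
qed

text \<open>The products differ on the edges with exactly one endpoint among the disagreeing sites,
  and there by 2 in absolute value. Such edges are counted by a product of two complementary
  cardinalities.\<close>

lemma sum_spin_products_diff_ge:
  assumes s: "\<sigma> \<in> spins n" "\<tau> \<in> spins n" and n: "1 \<le> n"
  shows "(\<Sum>e\<in>edges n. (spin_products \<sigma> e - spin_products \<tau> e)\<^sup>2)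
      \<ge> 4 * (real n)\<^sup>2 * hamming n \<sigma> \<tau> * (1 - hamming n \<sigma> \<tau>)"
proof -
  define D where "D = {i \<in> {1..n}. \<sigma> i \<noteq> \<tau> i}"
  define D' where "D' = {1..n} - D"
  define m where "m = (\<lambda>(i, j). (min i j, max i (j::nat)))"
  have fin: "finite D" "finite D'" by (auto simp: D_def D'_def)
  \<comment> \<open>Sorting a pair loses nothing here: \<open>D\<close> and \<open>D'\<close> are
    disjoint, so each entry reveals which side it came from.\<close>
  have inj: "inj_on m (D \<times> D')"
    by (auto simp: inj_on_def m_def D'_def min_def max_def split: if_splits)
  have sub: "m ` (D \<times> D') \<subseteq> edges n"
  proof
    fix e assume "e \<in> m ` (D \<times> D')"
    then obtain i j where ij: "i \<in> D" "j \<in> D'" "e = m (i, j)" by (elim imageE SigmaE) simp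
    then have "i \<noteq> j" by (auto simp: D'_def)
    then show "e \<in> edges n" using ij by (auto simp: m_def edges_def D_def D'_def min_def max_def)
  qed
  have val: "(spin_products \<sigma> e - spin_products \<tau> e)\<^sup>2 = 4" if e: "e \<in> m ` (D \<times> D')" for e
  proof -
    obtain i j where ij: "i \<in> D" "j \<in> D'" "e = m (i, j)" using e by (elim imageE SigmaE) simp
    have "spin_products \<rho> e = \<rho> i * \<rho> j" for \<rho>
      using ij(3) by (auto simp: spin_products_def m_def min_def max_def)
    then show ?thesis
      using spins_values[OF s(1), of i] spins_values[OF s(2), of i]
        spins_values[OF s(1), of j] spins_values[OF s(2), of j] ij
      by (auto simp: D_def D'_def)
  qed
  have cD: "real (card D) = real n * hamming n \<sigma> \<tau>"
    using n by (simp add: hamming_def D_def)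
  have "card D' = n - card D"
    unfolding D'_def using fin by (subst card_Diff_subset) (auto simp: D_def)
  moreover have "card D \<le> n"
  proof -
    have "card D \<le> card {1..n}" by (intro card_mono) (auto simp: D_def)
    then show ?thesis by simp
  qed
  ultimately have cD': "real (card D') = real n * (1 - hamming n \<sigma> \<tau>)"
    using cD by (simp add: of_nat_diff algebra_simps)
  have "4 * (real n)\<^sup>2 * hamming n \<sigma> \<tau> * (1 - hamming n \<sigma> \<tau>) = 4 * (real (card D) * real (card D'))"
    unfolding cD cD' by (simp add: power2_eq_square)
  also have "\<dots> = (\<Sum>e\<in>m ` (D \<times> D'). 4)"
    using card_image[OF inj] by (simp add: card_cartesian_product)
  also have "\<dots> = (\<Sum>e\<in>m ` (D \<times> D'). (spin_products \<sigma> e - spin_products \<tau> e)\<^sup>2)"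
    using val by simp
  also have "\<dots> \<le> (\<Sum>e\<in>edges n. (spin_products \<sigma> e - spin_products \<tau> e)\<^sup>2)"
    by (intro sum_mono2 finite_edges sub) auto
  finally show ?thesis .
qed

lemma hamming_le_1: "hamming n \<sigma> \<tau> \<le> 1"
proof -
  have "card {i \<in> {1..n}. \<sigma> i \<noteq> \<tau> i} \<le> card {1..n}" by (intro card_mono) auto
  then have "real (card {i \<in> {1..n}. \<sigma> i \<noteq> \<tau> i}) \<le> real n" by simp
  then show ?thesis unfolding hamming_def by (cases "n = 0") (auto simp: divide_le_eq_1)
qed

text \<open>The triangle inequality through the negative of \<open>t\<close>: spins take two values,
  so where \<open>u\<close> and \<open>u'\<close> disagree one of them agrees with
  \<open>t\<close>.\<close>

lemma hamming_antipodal: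
  assumes "t \<in> spins n" "u \<in> spins n" "u' \<in> spins n" and n: "1 \<le> n"
  shows "hamming n u u' \<le> (1 - hamming n t u) + (1 - hamming n t u')"
proof -
  let ?A = "\<lambda>u. {i \<in> {1..n}. t i = u i}"
  have eq: "1 - hamming n t u = real (card (?A u)) / real n" for u
  proof -
    have "?A u \<union> {i \<in> {1..n}. t i \<noteq> u i} = {1..n}" by blast
    then have "card (?A u) + card {i \<in> {1..n}. t i \<noteq> u i} = card {1..n}"
      using card_Un_disjoint[of "?A u" "{i \<in> {1..n}. t i \<noteq> u i}"] by force
    then have "real (card (?A u)) + real (card {i \<in> {1..n}. t i \<noteq> u i}) = real n"
      by (simp flip: of_nat_add)
    then show ?thesis using n by (simp add: hamming_def field_simps)
  qed
  have "{i \<in> {1..n}. u i \<noteq> u' i} \<subseteq> ?A u \<union> ?A u'"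
    using spins_values[OF assms(1)] spins_values[OF assms(2)] spins_values[OF assms(3)] by force
  then have "card {i \<in> {1..n}. u i \<noteq> u' i} \<le> card (?A u \<union> ?A u')"
    by (intro card_mono) auto
  also have "\<dots> \<le> card (?A u) + card (?A u')" by (rule card_Un_le)
  finally have "real (card {i \<in> {1..n}. u i \<noteq> u' i}) \<le> real (card (?A u)) + real (card (?A u'))"
    by (simp flip: of_nat_add)
  then show ?thesis
    unfolding eq unfolding hamming_def add_divide_distrib[symmetric] by (rule divide_right_mono) simp
qed

definition separated :: "('s \<Rightarrow> 's \<Rightarrow> real) \<Rightarrow> real \<Rightarrow> 's set \<Rightarrow> bool" where
  "separated d \<epsilon> B \<longleftrightarrow> (\<forall>x\<in>B. \<forall>y\<in>B. x \<noteq> y \<longrightarrow> d x y > \<epsilon>)"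

text \<open>Spin products do not distinguish a configuration from its negative, so besides itself a
  configuration may have one nearby partner, close to its antipode.\<close>

lemma card_near_le_2:
  assumes T: "T \<subseteq> spins n" "separated (hamming n) \<epsilon> T" "t \<in> T" and n: "1 \<le> n" and e: "\<epsilon> > 0"
  shows "card {u \<in> T. (\<Sum>e\<in>edges n. (1 / real n * spin_products t e - 1 / real n * spin_products u e)\<^sup>2) < 2 * \<epsilon>\<^sup>2} \<le> 2"
    (is "card ?A \<le> 2")
proof -
  \<comment> \<open>This explains the threshold \<open>2 * \<epsilon>\<^sup>2\<close>: together with
    separation it puts every close point other than \<open>t\<close> within
    \<open>\<epsilon> / 2\<close> of the antipode of \<open>t\<close>, so two such points would
    violate separation from each other.\<close>
  have anti: "1 - hamming n t u < \<epsilon> / 2" if u: "u \<in> ?A" "u \<noteq> t" for u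
  proof -
    have h: "hamming n t u > \<epsilon>" using T u by (auto simp: separated_def)
    have "4 * hamming n t u * (1 - hamming n t u)
       = (1 / real n)\<^sup>2 * (4 * (real n)\<^sup>2 * hamming n t u * (1 - hamming n t u))"
      using n by (simp add: power2_eq_square)
    also have "\<dots> \<le> (1 / real n)\<^sup>2 * (\<Sum>e\<in>edges n. (spin_products t e - spin_products u e)\<^sup>2)"
      using T u n by (intro mult_left_mono sum_spin_products_diff_ge) auto
    also have "\<dots> = (\<Sum>e\<in>edges n. (1 / real n * spin_products t e - 1 / real n * spin_products u e)\<^sup>2)"
      unfolding sum_distrib_left by (intro sum.cong refl) (simp add: power_mult_distrib[symmetric] right_diff_distrib)
    also have "\<dots> < 2 * \<epsilon>\<^sup>2" using u by simp
    finally have 1: "4 * hamming n t u * (1 - hamming n t u) < 2 * \<epsilon>\<^sup>2" .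
    have "4 * \<epsilon> * (1 - hamming n t u) \<le> 4 * hamming n t u * (1 - hamming n t u)"
      using h hamming_le_1[of n t u] by (intro mult_right_mono) auto
    with 1 have "\<epsilon> * (4 * (1 - hamming n t u)) < \<epsilon> * (2 * \<epsilon>)"
      by (simp add: power2_eq_square mult_ac)
    then show ?thesis using e by simp
  qed
  have uniq: "u = u'" if u: "u \<in> ?A" "u \<noteq> t" "u' \<in> ?A" "u' \<noteq> t" for u u'
  proof (rule ccontr)
    assume "u \<noteq> u'"
    then have "hamming n u u' > \<epsilon>" using T u by (auto simp: separated_def)
    moreover have "hamming n u u' \<le> (1 - hamming n t u) + (1 - hamming n t u')"
      using T u n by (intro hamming_antipodal) auto
    ultimately show False using anti[of u] anti[of u'] u by simp
  qed
  have "\<exists>u. ?A \<subseteq> {t, u}"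
  proof (cases "?A \<subseteq> {t}")
    case False
    then obtain u where "u \<in> ?A" "u \<noteq> t" by auto
    then show ?thesis using uniq by (intro exI[of _ u]) blast
  qed auto
  then obtain u where "?A \<subseteq> {t, u}" by blast
  then have "card ?A \<le> card {t, u}" by (intro card_mono) auto
  also have "\<dots> \<le> 2" by (simp add: card_insert_if)
  finally show ?thesis .
qed

section \<open>Packings, resampled optimizers and moments of the couplings\<close>

lemma packing_number_witness:
  assumes "finite T"
  obtains B where "B \<subseteq> T" "card B = packing_number T d \<epsilon>" "separated d \<epsilon> B"
proof -
  let ?C = "{card B | B. finite B \<and> B \<subseteq> T \<and> (\<forall>x\<in>B. \<forall>y\<in>B. x \<noteq> y \<longrightarrow> d x y > \<epsilon>)}"
  have "?C \<subseteq> card ` Pow T" by auto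
  then have "finite ?C" by (rule finite_subset) (simp add: assms)
  moreover have "?C \<noteq> {}" by (auto intro!: exI[of _ "{}"])
  ultimately have "Max ?C \<in> ?C" by (rule Max_in)
  then show ?thesis using that by (auto simp: packing_number_def separated_def)
qed

lemma perturbed_optimizer_near_maximal:
  assumes n: "2 \<le> n" and l: "l \<in> edges n" and R: "\<bar>X l \<omega>\<bar> \<le> R" "\<bar>Y l \<omega>\<bar> \<le> R"
  defines "t \<equiv> arg_min_on (sk_hamiltonian n (perturbed_input (edges n) {l} X Y \<omega>)) (spins n)"
  shows "t \<in> spins n"
    and "Max ((\<lambda>u. lin (edges n) (spin_products u) (random_vector (edges n) X \<omega>)) ` spins n) - 4 * R
      \<le> lin (edges n) (spin_products t) (random_vector (edges n) X \<omega>)"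
proof -
  let ?x = "random_vector (edges n) X \<omega>" and ?y = "perturbed_input (edges n) {l} X Y \<omega>"
  let ?E = "\<lambda>u x. lin (edges n) (spin_products u) x"
  have ne: "spins n \<noteq> {}" using n by (intro spins_nonempty) auto
  show t: "t \<in> spins n"
    unfolding t_def by (rule arg_min_if_finite(1)[OF finite_spins ne])
  have "\<not> (\<exists>u\<in>spins n. sk_hamiltonian n ?y u < sk_hamiltonian n ?y t)"
    unfolding t_def by (rule arg_min_if_finite(2)[OF finite_spins ne])
  then have opt: "?E u ?y \<le> ?E t ?y" if "u \<in> spins n" for u
    using that by (auto simp: sk_hamiltonian_eq not_less)
  have sum: "(\<Sum>e\<in>edges n. \<bar>?x e - ?y e\<bar>) \<le> 2 * R"
  proof -
    have "(\<Sum>e\<in>edges n. \<bar>?x e - ?y e\<bar>) = (\<Sum>e\<in>edges n. if e = l then \<bar>X l \<omega> - Y l \<omega>\<bar> else 0)"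
      by (intro sum.cong) (auto simp: random_vector_def perturbed_input_def)
    also have "\<dots> = \<bar>X l \<omega> - Y l \<omega>\<bar>" using l finite_edges by simp
    finally show ?thesis using R by linarith
  qed
  have sum': "(\<Sum>e\<in>edges n. \<bar>?y e - ?x e\<bar>) \<le> 2 * R"
    using sum by (simp add: abs_minus_commute)
  \<comment> \<open>Passing to the perturbed input and back costs \<open>2 * R\<close> each way,
    once for the competitor \<open>u\<close> and once for \<open>t\<close>.\<close>
  have "?E u ?x \<le> ?E t ?x + 4 * R" if u: "u \<in> spins n" for u
  proof -
    have "?E u ?x \<le> ?E u ?y + 2 * R"
      using lin_diff_le[of "edges n" "spin_products u" ?x ?y] spin_products_abs[OF u] sum by auto
    also have "?E u ?y \<le> ?E t ?y" using u by (rule opt)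
    also have "?E t ?y \<le> ?E t ?x + 2 * R"
      using lin_diff_le[of "edges n" "spin_products t" ?y ?x] spin_products_abs[OF t] sum' by auto
    finally show ?thesis by simp
  qed
  then have "Max ((\<lambda>u. ?E u ?x) ` spins n) \<le> ?E t ?x + 4 * R"
    using finite_spins ne by (subst Max_le_iff) auto
  then show "Max ((\<lambda>u. ?E u ?x) ` spins n) - 4 * R \<le> ?E t ?x" by simp
qed

text \<open>Stated for a whole random vector because a copy is specified through its joint
  law.\<close>

lemma distr_PiM_abs_component:
  assumes Z: "Z \<in> measurable M (PiM I (\<lambda>_. borel))" "distr M (PiM I (\<lambda>_. borel)) Z = PiM I (\<lambda>_. P)"
    and P: "prob_space P" "sets P = sets borel" "integrable P (\<lambda>x. x)" and e: "e \<in> I"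
  shows "integrable M (\<lambda>\<omega>. \<bar>Z \<omega> e\<bar> :: real)"
    and "(\<integral>\<omega>. \<bar>Z \<omega> e\<bar> \<partial>M) = (\<integral>x. \<bar>x\<bar> \<partial>P)"
proof -
  have m: "(\<lambda>x. \<bar>x e\<bar>) \<in> borel_measurable (PiM I (\<lambda>_. borel :: real measure))"
    using e by measurable
  note [measurable_cong] = P(2)
  show "integrable M (\<lambda>\<omega>. \<bar>Z \<omega> e\<bar>)"
    using integrable_PiM_component[OF P(1) integrable_abs[OF P(3)] e]
    unfolding Z(2)[symmetric] integrable_distr_eq[OF Z(1) m] .
  have "(\<lambda>x. \<bar>x\<bar>) \<in> borel_measurable P" by measurable
  from integral_PiM_component[OF P(1) this e]
  show "(\<integral>\<omega>. \<bar>Z \<omega> e\<bar> \<partial>M) = (\<integral>x. \<bar>x\<bar> \<partial>P)"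
    unfolding Z(2)[symmetric] integral_distr[OF Z(1) m] .
qed

section \<open>Stability: constants, two exceptional events and their probabilities\<close>

theorem theorem3p2p2:
  fixes P :: "real measure" and f :: "real \<Rightarrow> real"
    and M :: "nat \<Rightarrow> 'w measure"
    and X :: "nat \<Rightarrow> nat \<times> nat \<Rightarrow> 'w \<Rightarrow> real"
    and Y :: "nat \<Rightarrow> nat \<times> nat \<Rightarrow> nat \<times> nat \<Rightarrow> 'w \<Rightarrow> real"
  assumes "prob_space P"
    and "f \<in> borel_measurable borel" and "\<And>x. f x \<ge> 0"
    and "P = density lborel (\<lambda>x. ennreal (f x))"
    and "integrable P (\<lambda>x. x)" and "(\<integral>x. x \<partial>P) = 0"
    and "rejection_assumption P f"
    and "\<And>n. prob_space (M n)"
    and "\<And>n. prob_space.indep_vars (M n) (\<lambda>_. borel) (X n) (edges n)"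
    and "\<And>n e. e \<in> edges n \<Longrightarrow> distr (M n) borel (X n e) = P"
    and "\<And>n l. l \<in> edges n \<Longrightarrow> independent_copy (M n) (edges n) (X n) (Y n l)"
  shows "stable_under_small_perturbations M edges X Y spins hamming sk_hamiltonian
           edges (\<lambda>n l. {l})"
  unfolding stable_under_small_perturbations_def
proof (intro conjI allI impI)
  fix n show "perturbation_blocks (edges n) (edges n) (\<lambda>l. {l})"
    by (simp add: perturbation_blocks_def finite_edges)
next
  fix \<epsilon> \<delta> :: real assume eps: "0 < \<epsilon>" and del: "0 < \<delta>"
  have sP: "sets P = sets borel" using assms(4) by simp
  define m where "m = (\<integral>x. \<bar>x\<bar> \<partial>P)"
  have m: "m \<ge> 0" by (simp add: m_def)
  have "(1::real) \<ge> 0" by simp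
  then obtain C where C: "C > 0" and
    rej: "\<And>s. s \<ge> 0 \<Longrightarrow> (\<integral>(x, w). \<bar>w\<bar> powr 1 * max 0 (1 - f (x + s * w) / f x) \<partial>(P \<Otimes>\<^sub>M std_gauss)) \<le> C * s"
    using assms(7) unfolding rejection_assumption_def by meson
  \<comment> \<open>Chosen for Markov's inequality: the mean size of the two couplings at an edge is
    \<open>2 * m\<close>, so the bound \<open>2 * m / (\<epsilon> * R)\<close> is at most
    \<open>\<delta> / 2\<close>. The added 1 makes \<open>R\<close> visibly positive.\<close>
  define R where "R = 4 * (m + 1) / (\<epsilon> * \<delta>)"
  have R: "R > 0" using m eps del by (simp add: R_def)
  \<comment> \<open>Chosen so that with separation \<open>a = 2 * \<epsilon>\<^sup>2\<close> and
    slack \<open>r = 4 * R\<close> the net gain is \<open>2 * C / \<delta>\<close>. As the total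
    cost is at most \<open>C\<close>, the event then has probability at most
    \<open>\<delta> / 2\<close>.\<close>
  define l where "l = 2 * (4 * R + 2 * C / \<delta>) / \<epsilon>\<^sup>2"
  have l: "l \<ge> 0" using R C eps del by (simp add: l_def)
  have gain: "l * (2 * \<epsilon>\<^sup>2) / 4 - 4 * R = 2 * C / \<delta>"
  proof -
    have 1: "l * \<epsilon>\<^sup>2 = 2 * (4 * R + 2 * C / \<delta>)" using eps by (simp add: l_def)
    have "l * (2 * \<epsilon>\<^sup>2) / 4 - 4 * R = (l * \<epsilon>\<^sup>2) / 2 - 4 * R" by simp
    also have "\<dots> = 2 * C / \<delta>" unfolding 1 using del by (simp add: field_simps)
    finally show ?thesis .
  qed
  define K where "K = 4 * exp (8 * l\<^sup>2)"
  have K: "K > 0" by (simp add: K_def)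
  \<comment> \<open>For \<open>n < 2\<close> there are no edges; the limsup ignores these
    indices.\<close>
  have bound: "measure (M n) {\<omega> \<in> space (M n).
      real (Min {packing_number (perturbed_optimizers (edges n) (\<lambda>l. {l}) (X n) (Y n) (spins n) (sk_hamiltonian n) A \<omega>)
                       (hamming n) \<epsilon>
                     | A. A \<subseteq> edges n \<and> real (card A) > (1 - \<epsilon>) * real (card (edges n))}) \<ge> K} \<le> \<delta>"
    (is "measure _ ?E \<le> \<delta>") if n: "2 \<le> n" for n
  proof -
    let ?I = "edges n" and ?B = "PiM (edges n) (\<lambda>_. borel :: real measure)"
    interpret Mn: prob_space "M n" by (rule assms(8))
    define N where "N = real (card ?I)"
    have N: "N > 0" using edges_nonempty[OF n] finite_edges by (simp add: N_def card_gt_0_iff)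
    define F where "F = {T. T \<subseteq> spins n \<and> separated (hamming n) \<epsilon> T \<and> K \<le> real (card T)}"
    have finF: "finite F"
      by (rule finite_subset[of _ "Pow (spins n)"]) (auto simp: F_def finite_spins)
    define B where "B = {x \<in> space ?B. \<exists>T\<in>F. \<forall>t\<in>T.
      Max ((\<lambda>u. lin ?I (spin_products u) x) ` spins n) - 4 * R \<le> lin ?I (spin_products t) x}"
    have X_rv: "X n e \<in> borel_measurable (M n)" if "e \<in> ?I" for e
      using assms(9)[of n] that unfolding Mn.indep_vars_def by auto
    have dX: "distr (M n) ?B (random_vector ?I (X n)) = PiM ?I (\<lambda>_. P)"
    proof -
      have "distr (M n) ?B (\<lambda>\<omega>. \<lambda>i\<in>?I. X n i \<omega>) = PiM ?I (\<lambda>i. distr (M n) borel (X n i))"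
        using Mn.indep_vars_iff_distr_eq_PiM'[where M'="\<lambda>_. borel" and X="X n", OF edges_nonempty[OF n]] X_rv assms(9)[of n]
        by blast
      also have "\<dots> = PiM ?I (\<lambda>_. P)" using assms(10) by (intro PiM_cong) auto
      finally show ?thesis by (simp add: random_vector_def[abs_def])
    qed
    have mX: "random_vector ?I (X n) \<in> measurable (M n) ?B"
      unfolding random_vector_def[abs_def] using X_rv by measurable
    have copy: "random_vector ?I (Y n e) \<in> measurable (M n) ?B"
       "distr (M n) ?B (random_vector ?I (Y n e)) = PiM ?I (\<lambda>_. P)" if e: "e \<in> ?I" for e
      using assms(11)[OF e] dX unfolding independent_copy_def by (auto dest: Mn.indep_var_rv2)
    have sz: "T \<noteq> {}" if "T \<in> F" for T using that K by (auto simp: F_def)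
    have sq: "(1 / real n)\<^sup>2 * (real n)\<^sup>2 = 1" using n by (simp add: power_divide)
    have nrm: "(\<Sum>e\<in>?I. (1 / real n * spin_products t e)\<^sup>2) \<le> 1" if "t \<in> spins n" for t
    proof -
      have "(\<Sum>e\<in>?I. (1 / real n * spin_products t e)\<^sup>2) = (\<Sum>e\<in>?I. (1 / real n)\<^sup>2)"
      proof (intro sum.cong refl)
        fix e assume "e \<in> ?I"
        then have "(spin_products t e)\<^sup>2 = 1"
          using spin_products_abs[OF that] power2_abs[of "spin_products t e"] by simp
        then show "(1 / real n * spin_products t e)\<^sup>2 = (1 / real n)\<^sup>2"
          by (simp only: power_mult_distrib mult_1_right)
      qed
      also have "\<dots> = (1 / real n)\<^sup>2 * N" by (simp add: N_def)
      also have "\<dots> \<le> (1 / real n)\<^sup>2 * (real n)\<^sup>2"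
        unfolding N_def by (intro mult_left_mono card_edges_le) auto
      finally show ?thesis using sq by simp
    qed
    have 1: "B \<in> sets ?B"
      "measure (PiM ?I (\<lambda>_. P)) B * (l * (2 * \<epsilon>\<^sup>2) / 4 - 4 * R) \<le> N * (C * (1 / real n)\<^sup>2)"
    proof -
      have s0: "0 \<le> 1 / real n" and a0: "0 \<le> 2 * \<epsilon>\<^sup>2" by auto
      have ne: "spins n \<noteq> {}" using n by (intro spins_nonempty) simp
      have v: "\<bar>spin_products t e\<bar> \<le> 1" if "t \<in> spins n" "e \<in> ?I" for t e
        using spin_products_abs[OF that] by simp
      have sub: "T \<subseteq> spins n" and size: "4 * exp (8 * l\<^sup>2) \<le> real (card T)" if "T \<in> F" for T
        using that by (simp_all add: F_def K_def)
      have near: "card {u \<in> T. (\<Sum>e\<in>?I. (1 / real n * spin_products t e - 1 / real n * spin_products u e)\<^sup>2) < 2 * \<epsilon>\<^sup>2} \<le> 2"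
        if "T \<in> F" "t \<in> T" for T t
        using that n eps by (intro card_near_le_2) (auto simp: F_def)
      note result = prob_near_maximizers_le[where v=spin_products and r="4 * R", OF assms(1,4,5,2,3) rej[OF s0] s0 l a0
        finite_edges finite_spins ne finF v sub sz nrm near size]
      show "B \<in> sets ?B" unfolding B_def by (rule result(1))
      show "measure (PiM ?I (\<lambda>_. P)) B * (l * (2 * \<epsilon>\<^sup>2) / 4 - 4 * R) \<le> N * (C * (1 / real n)\<^sup>2)"
        unfolding B_def N_def by (rule result(2))
    qed
    have "N * (C * (1 / real n)\<^sup>2) \<le> (real n)\<^sup>2 * (C * (1 / real n)\<^sup>2)"
      unfolding N_def using C by (intro mult_right_mono card_edges_le) auto
    also have "\<dots> = C" using n by (simp add: power_divide)
    finally have "measure (PiM ?I (\<lambda>_. P)) B * (2 * C / \<delta>) \<le> C" using 1(2) unfolding gain by simp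
    then have "measure (PiM ?I (\<lambda>_. P)) B \<le> \<delta> / 2"
      using C del by (simp add: field_simps)
    moreover define EB where "EB = random_vector ?I (X n) -` B \<inter> space (M n)"
    have "measure (PiM ?I (\<lambda>_. P)) B = measure (M n) EB"
      unfolding dX[symmetric] EB_def using mX 1(1) by (rule measure_distr)
    ultimately have pB: "measure (M n) EB \<le> \<delta> / 2" by simp
    \<comment> \<open>Each copy enters only at its own edge. The mean of \<open>Z\<close> uses
      linearity alone, so the copies may depend on each other arbitrarily.\<close>
    define Z where "Z \<omega> = (\<Sum>e\<in>?I. \<bar>random_vector ?I (X n) \<omega> e\<bar> + \<bar>random_vector ?I (Y n e) \<omega> e\<bar>)" for \<omega>
    note cX = distr_PiM_abs_component[OF mX dX assms(1) sP assms(5)]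
    note cY = distr_PiM_abs_component[OF copy assms(1) sP assms(5)]
    have iZ: "integrable (M n) Z"
      unfolding Z_def using cX(1) cY(1) by (intro Bochner_Integration.integrable_sum Bochner_Integration.integrable_add) auto
    have EZ: "(\<integral>\<omega>. Z \<omega> \<partial>M n) = 2 * m * N"
      unfolding Z_def N_def using cX cY by (simp add: Bochner_Integration.integral_sum m_def)
    have Z_nonneg: "Z \<omega> \<ge> 0" for \<omega> by (auto simp: Z_def intro!: sum_nonneg)
    define EZset where "EZset = {\<omega> \<in> space (M n). \<epsilon> * N * R \<le> Z \<omega>}"
    have pZ: "measure (M n) EZset \<le> \<delta> / 2"
    proof -
      have "measure (M n) EZset \<le> (\<integral>\<omega>. Z \<omega> \<partial>M n) / (\<epsilon> * N * R)"
        unfolding EZset_def using iZ Z_nonneg N R eps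
        by (intro integral_Markov_inequality_measure[where A="{}"]) auto
      also have "\<dots> = 2 * m / (\<epsilon> * R)" using N by (simp add: EZ)
      also have "\<dots> \<le> \<delta> / 2"
      proof -
        have "\<delta> * (\<epsilon> * R) = 4 * (m + 1)" using eps del by (simp add: R_def)
        then have "2 * m \<le> \<delta> / 2 * (\<epsilon> * R)" by simp
        then show ?thesis using eps R by (intro mult_imp_div_pos_le) auto
      qed
      finally show ?thesis .
    qed
    have EZ_meas: "EZset \<in> sets (M n)"
      unfolding EZset_def using borel_measurable_integrable[OF iZ] by measurable
    have EB_meas: "EB \<in> sets (M n)" unfolding EB_def using mX 1(1) by (rule measurable_sets)
    have sub: "?E \<subseteq> EB \<union> EZset"
    proof
      fix \<omega> assume \<omega>: "\<omega> \<in> ?E"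
      \<comment> \<open>The witness for the minimum over \<open>A\<close>. It may depend on the
        sample point, because the minimum is taken inside the probability.\<close>
      define G where "G = {e \<in> ?I. \<bar>X n e \<omega>\<bar> \<le> R \<and> \<bar>Y n e e \<omega>\<bar> \<le> R}"
      have finG: "finite G" using finite_edges by (simp add: G_def)
      show "\<omega> \<in> EB \<union> EZset"
      proof (cases "real (card G) > (1 - \<epsilon>) * N")
        case True
        let ?O = "\<lambda>A. perturbed_optimizers ?I (\<lambda>l. {l}) (X n) (Y n) (spins n) (sk_hamiltonian n) A \<omega>"
        let ?C = "{packing_number (?O A) (hamming n) \<epsilon> | A. A \<subseteq> ?I \<and> real (card A) > (1 - \<epsilon>) * real (card ?I)}"
        have "finite ?C"
          by (rule finite_subset[of _ "(\<lambda>A. packing_number (?O A) (hamming n) \<epsilon>) ` Pow ?I"]) (auto simp: finite_edges)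
        moreover have "packing_number (?O G) (hamming n) \<epsilon> \<in> ?C"
          using True by (auto simp: G_def N_def)
        \<comment> \<open>If \<open>G\<close> is admissible, a large minimum forces a large packing
          among the optimizers of \<open>G\<close> alone, and all of these are near-maximal for the
          unperturbed input.\<close>
        ultimately have "Min ?C \<le> packing_number (?O G) (hamming n) \<epsilon>" by (rule Min_le)
        moreover have "K \<le> real (Min ?C)" using \<omega> by simp
        ultimately have K_le: "K \<le> real (packing_number (?O G) (hamming n) \<epsilon>)" by linarith
        have "finite (?O G)" using finG by (simp add: perturbed_optimizers_def)
        then obtain T where T: "T \<subseteq> ?O G" "card T = packing_number (?O G) (hamming n) \<epsilon>"
            "separated (hamming n) \<epsilon> T"
          by (rule packing_number_witness)
        have near: "t \<in> spins n \<and> Max ((\<lambda>u. lin ?I (spin_products u) (random_vector ?I (X n) \<omega>)) ` spins n) - 4 * R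
            \<le> lin ?I (spin_products t) (random_vector ?I (X n) \<omega>)" if t: "t \<in> ?O G" for t
        proof -
          obtain e where e: "e \<in> G" "t = arg_min_on (sk_hamiltonian n (perturbed_input ?I {e} (X n) (Y n e) \<omega>)) (spins n)"
            using t unfolding perturbed_optimizers_def by (elim imageE)
          then show ?thesis
            using perturbed_optimizer_near_maximal[OF n, of e "X n" \<omega> R "Y n e"] by (auto simp: G_def)
        qed
        have "T \<in> F" using T K_le near by (auto simp: F_def)
        moreover have "random_vector ?I (X n) \<omega> \<in> space ?B"
          using \<omega> by (auto intro!: measurable_space[OF mX])
        ultimately have "random_vector ?I (X n) \<omega> \<in> B"
          unfolding B_def using T(1) near by blast
        then show ?thesis using \<omega> by (auto simp: EB_def)
      next
        case False
        have "card G + card (?I - G) = card ?I"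
          using finite_edges by (subst card_Diff_subset) (auto simp: G_def finite_edges intro!: le_add_diff_inverse card_mono)
        then have "real (card G) + real (card (?I - G)) = N"
          by (simp add: N_def flip: of_nat_add)
        \<comment> \<open>Otherwise at least a fraction \<open>\<epsilon>\<close> of the edges lies
          outside \<open>G\<close>, and each of them contributes more than \<open>R\<close> to
          \<open>Z\<close>.\<close>
        then have "\<epsilon> * N \<le> real (card (?I - G))" using False by (simp add: algebra_simps)
        then have "\<epsilon> * N * R \<le> real (card (?I - G)) * R" using R by (intro mult_right_mono) auto
        also have "\<dots> = (\<Sum>e\<in>?I - G. R)" by simp
        also have "\<dots> \<le> (\<Sum>e\<in>?I - G. \<bar>random_vector ?I (X n) \<omega> e\<bar> + \<bar>random_vector ?I (Y n e) \<omega> e\<bar>)"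
          by (intro sum_mono) (auto simp: G_def random_vector_def not_le)
        also have "\<dots> \<le> Z \<omega>"
          unfolding Z_def by (intro sum_mono2) (auto simp: finite_edges)
        finally show ?thesis using \<omega> by (auto simp: EZset_def)
      qed
    qed
    \<comment> \<open>Monotonicity asks only the covering event to be measurable; were
      \<open>?E\<close> not measurable, its measure would be 0 by convention.\<close>
    have "measure (M n) ?E \<le> measure (M n) (EB \<union> EZset)"
    proof (rule Mn.finite_measure_mono[OF sub])
      show "EB \<union> EZset \<in> sets (M n)" using EB_meas EZ_meas by auto
    qed
    also have "\<dots> \<le> measure (M n) EB + measure (M n) EZset"
      using EB_meas EZ_meas by (rule measure_Un_le)
    also have "\<dots> \<le> \<delta>" using pB pZ by simp
    finally show ?thesis .
  qed
  show "\<exists>K::real.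
        limsup (\<lambda>n. ereal (\<P>(\<omega> in M n.
          real (Min {packing_number (perturbed_optimizers (edges n) (\<lambda>l. {l}) (X n) (Y n) (spins n) (sk_hamiltonian n) A \<omega>)
                       (hamming n) \<epsilon>
                     | A. A \<subseteq> edges n \<and> real (card A) > (1 - \<epsilon>) * real (card (edges n))}) \<ge> K)))
        \<le> ereal \<delta>"
    using bound by (intro exI[of _ K] Limsup_bounded eventually_sequentiallyI[of 2]) auto
qed

end
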